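(* Let $\ell\ge2$ and let $\mathcal R$ be a merging $\ell$-vertex rule. If $\mathcal R$ is locally convergent, with limiting functions $\rho_k=\rho_k^{\mathcal R}$, then $\mathcal R$ is globally convergent, and the limiting function $\rho=\rho^{\mathcal R}$ is continuous on $[0,\infty)$ and satisfies $\rho(t)=1-\sum_{k\ge1}\rho_k(t)$ for all $t\ge0$.
   Context: $\ell$-vertex rule: fix an integer $\ell\ge2$. For each $n$, let $(\underline v_1,\underline v_2,\dots)$ be an i.i.d. sequence, where each $\underline v_m=(v_{m,1},\dots,v_{m,\ell})$ consists of $\ell$ vertices of $[n]$ chosen independently and uniformly at random. There is a filtration $\mathcal F_0\subseteq\mathcal F_1\subseteq\cdots$ such that $\underline v_m$ is $\mathcal F_m$-measurable and independent of $\mathcal F_{m-1}$. An $\ell$-vertex rule is, for each $n$, a random sequence of graphs $(G(m))_{m\ge0}=(G_n^{\mathcal R}(m))$ on $[n]$ such that: (i) $G(0)$ is empty; (ii) for $m\ge1$, $G(m)=G(m-1)\cup E_m$ where $E_m$ is a (possibly empty) $\mathcal F_m$-measurable set of edges each joining two vertices of $\underline v_m$; (iii) if the $\ell$ vertices of $\underline v_m$ lie in $\ell$ distinct components of $G(m-1)$, then $E_m\ne\varnothing$. Merging: for every $\varepsilon>0$, $n$, $m\ge1$, whenever $C,C'$ are distinct components of $G(m-1)$ with $|C|,|C'|\ge\varepsilon n$, conditional on $\mathcal F_{m-1}$ the probability that $C$ and $C'$ lie in the same component of $G(m)$ is at least $\varepsilon^\ell$. Notation: $N_k(m)$ is the number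 of vertices of $G(m)$ in components with exactly $k$ vertices; $L_1(m)$ is the number of vertices in a largest component of $G(m)$; $\xrightarrow{p}$ denotes convergence in probability as $n\to\infty$. Local convergence: there exist functions $\rho_k:[0,\infty)\to[0,1]$ such that for each fixed integer $k\ge1$ and real $t\ge0$, $N_k(\lfloor tn\rfloor)/n\xrightarrow{p}\rho_k(t)$. Global convergence: there exists an increasing function $\rho:[0,\infty)\to[0,1]$ such that for every $t$ at which $\rho$ is continuous, $L_1(\lfloor tn\rfloor)/n\xrightarrow{p}\rho(t)$. *)

theory Defs
  imports "HOL-Probability.Probability"
begin

text \<open>Graphs on the vertex set [n] = {0..<n}, given by a set of (directed) pairs read
  as undirected edges; only pairs inside [n] x [n] are taken into account.\<close>

definition conn :: "nat \<Rightarrow> (nat \<times> nat) set \<Rightarrow> nat \<Rightarrow> nat \<Rightarrow> bool" where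
  "conn n E x y \<longleftrightarrow>
     (x, y) \<in> ((E \<inter> ({..<n} \<times> {..<n})) \<union> (E \<inter> ({..<n} \<times> {..<n}))\<inverse>)\<^sup>*"

definition comp :: "nat \<Rightarrow> (nat \<times> nat) set \<Rightarrow> nat \<Rightarrow> nat set" where
  "comp n E x = {y. y < n \<and> conn n E x y}"

definition components :: "nat \<Rightarrow> (nat \<times> nat) set \<Rightarrow> nat set set" where
  "components n E = comp n E ` {..<n}"

definition graph_at :: "(nat \<Rightarrow> 'a \<Rightarrow> (nat \<times> nat) set) \<Rightarrow> nat \<Rightarrow> 'a \<Rightarrow> (nat \<times> nat) set" where
  "graph_at E m \<omega> = (\<Union>j\<in>{1..m}. E j \<omega>)"

definition Nk :: "nat \<Rightarrow> (nat \<times> nat) set \<Rightarrow> nat \<Rightarrow> nat" where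
  "Nk n G k = card {x. x < n \<and> card (comp n G x) = k}"

definition L1 :: "nat \<Rightarrow> (nat \<times> nat) set \<Rightarrow> nat" where
  "L1 n G = Max ((\<lambda>x. card (comp n G x)) ` {..<n})"

definition conv_in_prob :: "(nat \<Rightarrow> 'a measure) \<Rightarrow> (nat \<Rightarrow> 'a \<Rightarrow> real) \<Rightarrow> real \<Rightarrow> bool" where
  "conv_in_prob M X c \<longleftrightarrow>
     (\<forall>\<delta>>0. (\<lambda>n. measure (M n) {\<omega> \<in> space (M n). \<bar>X n \<omega> - c\<bar> > \<delta>}) \<longlonglongrightarrow> 0)"

definition ell_vertex_rule ::
  "nat \<Rightarrow> (nat \<Rightarrow> 'a measure) \<Rightarrow> (nat \<Rightarrow> nat \<Rightarrow> 'a measure)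
   \<Rightarrow> (nat \<Rightarrow> nat \<Rightarrow> 'a \<Rightarrow> nat list) \<Rightarrow> (nat \<Rightarrow> nat \<Rightarrow> 'a \<Rightarrow> (nat \<times> nat) set) \<Rightarrow> bool" where
  "ell_vertex_rule l M F v E \<longleftrightarrow>
    (\<forall>n\<ge>1.
      prob_space (M n) \<and>
      (\<forall>m. sets (F n m) \<subseteq> sets (M n) \<and> space (F n m) = space (M n)) \<and>
      (\<forall>m. sets (F n m) \<subseteq> sets (F n (Suc m))) \<and>
      (\<forall>m\<ge>1. v n m \<in> measurable (F n m) (count_space UNIV)) \<and>
      (\<forall>m\<ge>1. \<forall>\<omega>\<in>space (M n). length (v n m \<omega>) = l \<and> set (v n m \<omega>) \<subseteq> {..<n}) \<and>
      \<comment> \<open>v_m is uniform on [n]^l and independent of F_(m-1)\<close>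
      (\<forall>m\<ge>1. \<forall>A\<in>sets (F n (m - 1)). \<forall>xs. length xs = l \<and> set xs \<subseteq> {..<n} \<longrightarrow>
          measure (M n) (A \<inter> {\<omega> \<in> space (M n). v n m \<omega> = xs})
            = measure (M n) A / real n ^ l) \<and>
      (\<forall>m\<ge>1. E n m \<in> measurable (F n m) (count_space UNIV)) \<and>
      \<comment> \<open>each edge of E_m joins two (distinct) vertices of v_m\<close>
      (\<forall>m\<ge>1. \<forall>\<omega>\<in>space (M n). \<forall>(a, b) \<in> E n m \<omega>.
          a \<noteq> b \<and> a \<in> set (v n m \<omega>) \<and> b \<in> set (v n m \<omega>)) \<and>
      \<comment> \<open>condition (iii)\<close>
      (\<forall>m\<ge>1. \<forall>\<omega>\<in>space (M n).
          (\<forall>i<l. \<forall>j<l. i \<noteq> j \<longrightarrow>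
             \<not> conn n (graph_at (E n) (m - 1) \<omega>) (v n m \<omega> ! i) (v n m \<omega> ! j))
          \<longrightarrow> E n m \<omega> \<noteq> {}))"

text \<open>Merging: conditional on F_(m-1), two distinct components C, C' of G(m-1) of size
  at least \<epsilon> n are merged in G(m) with probability at least \<epsilon>^l.  Stated via events:
  for every F_(m-1)-event A on which C and C' are components of G(m-1).\<close>
definition merging ::
  "nat \<Rightarrow> (nat \<Rightarrow> 'a measure) \<Rightarrow> (nat \<Rightarrow> nat \<Rightarrow> 'a measure)
   \<Rightarrow> (nat \<Rightarrow> nat \<Rightarrow> 'a \<Rightarrow> (nat \<times> nat) set) \<Rightarrow> bool" where
  "merging l M F E \<longleftrightarrow>
    (\<forall>\<epsilon>::real. \<epsilon> > 0 \<longrightarrow> (\<forall>n\<ge>1. \<forall>m\<ge>1. \<forall>C C'. \<forall>A \<in> sets (F n (m - 1)).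
       C \<noteq> C' \<and> real (card C) \<ge> \<epsilon> * real n \<and> real (card C') \<ge> \<epsilon> * real n \<and>
       A \<subseteq> {\<omega> \<in> space (M n). C \<in> components n (graph_at (E n) (m - 1) \<omega>) \<and>
                              C' \<in> components n (graph_at (E n) (m - 1) \<omega>)}
       \<longrightarrow> measure (M n) (A \<inter> {\<omega> \<in> space (M n).
                \<exists>x\<in>C. \<exists>y\<in>C'. conn n (graph_at (E n) m \<omega>) x y})
           \<ge> \<epsilon> ^ l * measure (M n) A))"

end

theory Submission
  imports Defs "HOL-Real_Asymp.Real_Asymp"
begin

text \<open>
  Let \<open>r k t\<close> be the limiting proportion of vertices in components of size at most \<open>k\<close>, so that
  \<open>\<rho> = 1 - lim r k\<close>. As long as \<open>\<epsilon> n\<close> of the vertices which were in components of size above \<open>K\<close>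
  at time \<open>s n\<close> are still in components of size below \<open>\<epsilon> n / (2 l)\<close>, each step merges two of these
  at most \<open>n / K\<close> components with probability at least \<open>(\<epsilon> / 2)\<^sup>l\<close>; this can only last for \<open>O(n / K)\<close>
  steps. The merging property then joins all components of linear size, of which there are boundedly
  many, in \<open>o(n)\<close> further steps. Hence \<open>L1 / n\<close> is asymptotically between \<open>\<rho>\<close> just before \<open>t\<close> and
  \<open>\<rho> t\<close>, and it remains to show that \<open>\<rho>\<close> has no jumps. It is an infimum of Lipschitz increasing
  functions, hence continuous from the right. A jump at \<open>t\<close> would force
  components of every large order of magnitude \<open>k\<close> to survive until time \<open>t\<close> untouched, in a proportion
  which does not tend to \<open>0\<close>.
\<close>

section \<open>Components\<close>

lemma conn_refl [simp]: "conn n g x x"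
  by (simp add: conn_def)

lemma conn_sym: "conn n g x y \<Longrightarrow> conn n g y x"
  unfolding conn_def by (metis sym_Un_converse sym_rtrancl symD)

lemma conn_trans: "conn n g x y \<Longrightarrow> conn n g y z \<Longrightarrow> conn n g x z"
  unfolding conn_def by (rule rtrancl_trans)

lemma conn_mono: "conn n g x y \<Longrightarrow> g \<subseteq> g' \<Longrightarrow> conn n g' x y"
  unfolding conn_def by (erule rtrancl_mono[THEN subsetD, rotated]) blast

lemma conn_edge: "(a, b) \<in> g \<Longrightarrow> a < n \<Longrightarrow> b < n \<Longrightarrow> conn n g a b"
  unfolding conn_def by (rule r_into_rtrancl) auto

lemma finite_comp [simp]: "finite (comp n g x)"
  by (simp add: comp_def)

lemma comp_subset: "comp n g x \<subseteq> {..<n}"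
  by (auto simp: comp_def)

lemma comp_self: "x < n \<Longrightarrow> x \<in> comp n g x"
  by (simp add: comp_def)

lemma comp_mono: "g \<subseteq> g' \<Longrightarrow> comp n g x \<subseteq> comp n g' x"
  by (auto simp: comp_def intro: conn_mono)

lemma card_comp_mono: "g \<subseteq> g' \<Longrightarrow> card (comp n g x) \<le> card (comp n g' x)"
  by (simp add: card_mono comp_mono)

lemma card_comp_le: "card (comp n g x) \<le> n"
  using card_mono[OF _ comp_subset, of n g x] by simp

lemma comp_cong_conn: "conn n g x y \<Longrightarrow> comp n g x = comp n g y"
  by (auto simp: comp_def intro: conn_trans conn_sym)

lemma comp_eq_iff: "y < n \<Longrightarrow> comp n g x = comp n g y \<longleftrightarrow> conn n g x y"
proof
  assume "y < n" "comp n g x = comp n g y"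
  then have "y \<in> comp n g x" using comp_self by simp
  then show "conn n g x y" by (simp add: comp_def)
qed (rule comp_cong_conn)

lemma comp_Int_empty:
  "comp n g x \<noteq> comp n g y \<Longrightarrow> comp n g x \<inter> comp n g y = {}"
proof (rule ccontr)
  assume "comp n g x \<noteq> comp n g y" "comp n g x \<inter> comp n g y \<noteq> {}"
  then obtain z where "conn n g x z" "conn n g y z" by (auto simp: comp_def)
  then have "comp n g x = comp n g y" using comp_cong_conn by metis
  then show False using \<open>comp n g x \<noteq> comp n g y\<close> by simp
qed

text \<open>A walk from \<open>x\<close> starts in the old component, and while it is there it
  cannot use an edge of \<open>e\<close>, since such an edge has no end in it. Hence it never
  leaves.\<close>

lemma comp_Un_untouched:
  assumes "\<And>a b. (a, b) \<in> e \<Longrightarrow> a \<notin> comp n g x \<and> b \<notin> comp n g x" and "x < n"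
  shows "comp n (g \<union> e) x = comp n g x"
proof
  show "comp n (g \<union> e) x \<subseteq> comp n g x"
  proof
    fix y assume "y \<in> comp n (g \<union> e) x"
    then have "(x, y) \<in> (((g \<union> e) \<inter> ({..<n} \<times> {..<n})) \<union> ((g \<union> e) \<inter> ({..<n} \<times> {..<n}))\<inverse>)\<^sup>*"
      by (simp add: comp_def conn_def)
    then show "y \<in> comp n g x"
    proof (induction rule: rtrancl_induct)
      case base
      then show ?case using assms(2) by (rule comp_self)
    next
      case (step y z)
      then have "((y, z) \<in> g \<or> (z, y) \<in> g) \<and> y < n \<and> z < n"
        using assms(1) by blast
      then have "conn n g y z" "z < n" by (auto intro: conn_edge conn_sym)
      then show ?case using step.IH by (auto simp: comp_def intro: conn_trans)
    qed
  qed
qed (simp add: comp_mono)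

text \<open>Every component for \<open>g\<close> lies inside a single component for
  \<open>g'\<close>. Sending the former to the latter maps the old components that meet
  \<open>W\<close> onto the new ones; the next two lemmas compare cardinalities through this
  map.\<close>

lemma comp_image_coarsen:
  assumes "g \<subseteq> g'" "W \<subseteq> {..<n}"
  shows "(\<lambda>C. \<Union>x\<in>C. comp n g' x) ` (comp n g ` W) = comp n g' ` W"
proof -
  have "(\<Union>y\<in>comp n g x. comp n g' y) = comp n g' x" if "x \<in> W" for x
  proof -
    have "comp n g' y = comp n g' x" if "y \<in> comp n g x" for y
      using that comp_cong_conn[OF conn_mono[OF _ assms(1)]] by (auto simp: comp_def)
    moreover have "x \<in> comp n g x" using that assms(2) by (auto intro: comp_self)
    ultimately show ?thesis by blast
  qed
  then show ?thesis by (auto simp: image_image)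
qed

lemma card_comp_image_mono:
  assumes "g \<subseteq> g'" "W \<subseteq> {..<n}"
  shows "card (comp n g' ` W) \<le> card (comp n g ` W)"
proof -
  have "finite (comp n g ` W)" using finite_subset[OF assms(2)] by simp
  from card_image_le[OF this, of "\<lambda>C. \<Union>x\<in>C. comp n g' x"]
  show ?thesis unfolding comp_image_coarsen[OF assms] .
qed

text \<open>Equal finite cardinalities would make the coarsening map injective, but it identifies
  the distinct old components of \<open>a\<close> and \<open>b\<close>.\<close>

lemma card_comp_image_less:
  assumes "g \<subseteq> g'" "W \<subseteq> {..<n}" "a \<in> W" "b \<in> W" "\<not> conn n g a b" "conn n g' a b"
  shows "card (comp n g' ` W) < card (comp n g ` W)"
proof (rule ccontr)
  let ?h = "\<lambda>C. \<Union>x\<in>C. comp n g' x"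
  have fin: "finite (comp n g ` W)" using finite_subset[OF assms(2)] by simp
  assume "\<not> ?thesis"
  then have "card (?h ` (comp n g ` W)) = card (comp n g ` W)"
    using card_comp_image_mono[OF assms(1,2)] comp_image_coarsen[OF assms(1,2)] by simp
  then have inj: "inj_on ?h (comp n g ` W)" using fin by (simp add: eq_card_imp_inj_on)
  have h: "?h (comp n g x) = comp n g' x" if "x \<in> W" for x
    using comp_image_coarsen[OF assms(1), of "{x}" n] that assms(2) by auto
  have "?h (comp n g a) = ?h (comp n g b)"
    using h assms(3,4) comp_cong_conn[OF assms(6)] by simp
  from inj_onD[OF inj this] have "comp n g a = comp n g b" using assms(3,4) by simp
  then show False using assms(2,4,5) comp_eq_iff by blast
qed

text \<open>Distinct components are disjoint subsets of the \<open>n\<close> vertices, and each one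
  counted here has size at least \<open>\<kappa>\<close>.\<close>

lemma card_comp_image_bound:
  assumes "W \<subseteq> {..<n}" "\<And>x. x \<in> W \<Longrightarrow> \<kappa> \<le> real (card (comp n g x))"
  shows "\<kappa> * card (comp n g ` W) \<le> n"
proof -
  have fin: "finite (comp n g ` W)" using finite_subset[OF assms(1)] by simp
  have "\<kappa> * card (comp n g ` W) = (\<Sum>C\<in>comp n g ` W. \<kappa>)" by simp
  also have "\<dots> \<le> (\<Sum>C\<in>comp n g ` W. real (card C))"
    using assms(2) by (intro sum_mono) auto
  also have "\<dots> = real (card (\<Union>C\<in>comp n g ` W. C))"
  proof -
    have "card (\<Union>C\<in>comp n g ` W. C) = (\<Sum>C\<in>comp n g ` W. card C)"
    proof (rule card_UN_disjoint[OF fin])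
      show "\<forall>C\<in>comp n g ` W. \<forall>D\<in>comp n g ` W. C \<noteq> D \<longrightarrow> C \<inter> D = {}"
      proof (intro ballI impI)
        fix C D assume "C \<in> comp n g ` W" "D \<in> comp n g ` W" "C \<noteq> D"
        then obtain x y where "x < n" "y < n" "C = comp n g x" "D = comp n g y" "C \<noteq> D"
          using assms(1) by blast
        then show "C \<inter> D = {}" using comp_Int_empty by metis
      qed
    qed auto
    then show ?thesis by simp
  qed
  also have "\<dots> \<le> n"
  proof -
    have "(\<Union>C\<in>comp n g ` W. C) \<subseteq> {..<n}" using comp_subset by blast
    from card_mono[OF _ this] show ?thesis by simp
  qed
  finally show ?thesis .
qed

text \<open>The entries are chosen one after another: the components of \<open>i\<close> earlier
  entries cover at most \<open>real i * b\<close> vertices of \<open>W\<close>, which leaves at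
  least \<open>q\<close> admissible values for the next entry.\<close>

lemma card_separated_lists:
  assumes "W \<subseteq> {..<n}" "\<And>x. x \<in> W \<Longrightarrow> real (card (comp n g x)) \<le> b" "0 \<le> q"
    and b: "0 \<le> b" and "q + real i * b \<le> card W"
  shows "q ^ i \<le> card {xs. length xs = i \<and> set xs \<subseteq> W \<and> distinct (map (comp n g) xs)}"
  using assms(5)
proof (induction i)
  case 0
  have "{xs. length xs = 0 \<and> set xs \<subseteq> W \<and> distinct (map (comp n g) xs)} = {[]}" by auto
  then show ?case by simp
next
  case (Suc i)
  have finW: "finite W" using finite_subset[OF assms(1)] by simp
  define D where "D i = {xs. length xs = i \<and> set xs \<subseteq> W \<and> distinct (map (comp n g) xs)}" for i
  define T where "T xs = {x\<in>W. comp n g x \<notin> comp n g ` set xs}" for xs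
  have finD: "finite (D i)" for i
    by (rule finite_subset[OF _ finite_lists_length_eq[OF finW, of i]]) (auto simp: D_def)
  have T: "q \<le> card (T xs)" if "xs \<in> D i" for xs
  proof -
    have "W - T xs \<subseteq> (\<Union>y\<in>set xs. comp n g y)"
    proof
      fix x assume x: "x \<in> W - T xs"
      then have "x \<in> comp n g x" using assms(1) by (auto intro: comp_self)
      then show "x \<in> (\<Union>y\<in>set xs. comp n g y)" using x by (auto simp: T_def)
    qed
    then have "card (W - T xs) \<le> card (\<Union>y\<in>set xs. comp n g y)"
      by (intro card_mono) auto
    also have "\<dots> \<le> (\<Sum>y\<in>set xs. card (comp n g y))" by (rule card_UN_le) simp
    finally have "real (card (W - T xs)) \<le> (\<Sum>y\<in>set xs. real (card (comp n g y)))"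
      by (metis of_nat_le_iff of_nat_sum)
    also have "\<dots> \<le> (\<Sum>y\<in>set xs. b)" using that assms(2) by (intro sum_mono) (auto simp: D_def)
    also have "\<dots> \<le> real i * b"
      using that b card_length[of xs] by (auto simp: D_def intro!: mult_right_mono)
    finally have "real (card (W - T xs)) \<le> real i * b" .
    moreover have "card (W - T xs) = card W - card (T xs)" "card (T xs) \<le> card W"
      using finW by (auto simp: T_def intro!: card_Diff_subset card_mono)
    ultimately have "real (card W) - real i * b \<le> card (T xs)" by linarith
    then show ?thesis using Suc.prems b by (simp add: algebra_simps)
  qed
  have "q ^ Suc i \<le> q * card (D i)"
    using Suc b assms(3) by (auto simp: D_def algebra_simps intro!: mult_left_mono)
  also have "\<dots> = (\<Sum>xs\<in>D i. q)" by simp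
  also have "\<dots> \<le> (\<Sum>xs\<in>D i. real (card (T xs)))" by (intro sum_mono T)
  also have "\<dots> = card (Sigma (D i) T)"
    using finD finW by (subst card_SigmaI) (auto simp: T_def)
  also have "\<dots> = card ((\<lambda>(xs, x). x # xs) ` Sigma (D i) T)"
    by (subst card_image) (auto simp: inj_on_def)
  also have "\<dots> \<le> card (D (Suc i))"
    using finD by (intro of_nat_mono card_mono) (auto simp: D_def T_def)
  finally show ?case by (simp add: D_def)
qed

lemma graph_at_0 [simp]: "graph_at E 0 \<omega> = {}"
  by (simp add: graph_at_def)

lemma graph_at_Suc: "graph_at E (Suc m) \<omega> = graph_at E m \<omega> \<union> E (Suc m) \<omega>"
  unfolding graph_at_def by (subst atLeastAtMostSuc_conv) auto

lemma graph_at_mono: "m \<le> m' \<Longrightarrow> graph_at E m \<omega> \<subseteq> graph_at E m' \<omega>"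
  unfolding graph_at_def by (rule UN_mono) auto

section \<open>The process on a fixed vertex set\<close>

text \<open>The rule for one fixed \<open>n\<close>. Steps are numbered \<open>Suc m\<close>, so
  that the past of a step is \<open>F m\<close> and neither \<open>m - 1\<close> nor
  \<open>m \<ge> 1\<close> has to be carried along.\<close>

locale vertex_process = prob_space M for M :: "'a measure" +
  fixes n l :: nat and F :: "nat \<Rightarrow> 'a measure" and v :: "nat \<Rightarrow> 'a \<Rightarrow> nat list"
    and E :: "nat \<Rightarrow> 'a \<Rightarrow> (nat \<times> nat) set"
  assumes n_pos: "1 \<le> n"
    and F_sub: "sets (F m) \<subseteq> events" and space_F [simp]: "space (F m) = space M"
    and F_Suc: "sets (F m) \<subseteq> sets (F (Suc m))"
    and v_meas: "v (Suc m) \<in> measurable (F (Suc m)) (count_space UNIV)"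
    and v_range: "\<omega> \<in> space M \<Longrightarrow> length (v (Suc m) \<omega>) = l \<and> set (v (Suc m) \<omega>) \<subseteq> {..<n}"
    and v_unif: "A \<in> sets (F m) \<Longrightarrow> length xs = l \<Longrightarrow> set xs \<subseteq> {..<n} \<Longrightarrow>
        prob (A \<inter> {\<omega> \<in> space M. v (Suc m) \<omega> = xs}) = prob A / real n ^ l"
    and E_meas: "E (Suc m) \<in> measurable (F (Suc m)) (count_space UNIV)"
    and E_range: "\<omega> \<in> space M \<Longrightarrow> (a, b) \<in> E (Suc m) \<omega> \<Longrightarrow>
        a \<noteq> b \<and> a \<in> set (v (Suc m) \<omega>) \<and> b \<in> set (v (Suc m) \<omega>)"
    and E_nonempty: "\<omega> \<in> space M \<Longrightarrow>
        (\<And>i j. i < l \<Longrightarrow> j < l \<Longrightarrow> i \<noteq> j \<Longrightarrow>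
           \<not> conn n (graph_at E m \<omega>) (v (Suc m) \<omega> ! i) (v (Suc m) \<omega> ! j)) \<Longrightarrow>
        E (Suc m) \<omega> \<noteq> {}"
begin

abbreviation G :: "nat \<Rightarrow> 'a \<Rightarrow> (nat \<times> nat) set" where
  "G \<equiv> graph_at E"

abbreviation all_graphs :: "(nat \<times> nat) set set" where
  "all_graphs \<equiv> Pow ({..<n} \<times> {..<n})"

lemma F_mono: "m \<le> m' \<Longrightarrow> sets (F m) \<subseteq> sets (F m')"
  by (rule lift_Suc_mono_le[of "\<lambda>m. sets (F m)"]) (auto intro: F_Suc[THEN subsetD])

lemma E_subset: "\<omega> \<in> space M \<Longrightarrow> E (Suc m) \<omega> \<in> all_graphs"
  using E_range v_range by fastforce

lemma G_subset: "\<omega> \<in> space M \<Longrightarrow> G m \<omega> \<in> all_graphs"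
proof (induction m)
  case (Suc m)
  then show ?case using E_subset[of \<omega> m] by (simp add: graph_at_Suc)
qed simp

text \<open>The target is the finite set \<open>all_graphs\<close>, whereas the sets of pairs of
  naturals are uncountable. With countably many values, measurability of the union follows by fixing
  the value of \<open>G m\<close>.\<close>

lemma G_measurable: "G m \<in> measurable (F m) (count_space all_graphs)"
proof (induction m)
  case 0
  have "G 0 = (\<lambda>_. {})" by (auto simp: fun_eq_iff)
  then show ?case by simp
next
  case (Suc m)
  have "measurable (F m) (count_space all_graphs) \<subseteq> measurable (F (Suc m)) (count_space all_graphs)"
    by (rule measurable_mono) (auto simp: F_Suc[THEN subsetD])
  with Suc have 1: "G m \<in> measurable (F (Suc m)) (count_space all_graphs)" by blast
  have 2: "(\<lambda>\<omega>. g \<union> E (Suc m) \<omega>) \<in> measurable (F (Suc m)) (count_space all_graphs)"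
    if "g \<in> all_graphs" for g
  proof (subst measurable_count_space_eq2, simp, intro conjI ballI)
    show "(\<lambda>\<omega>. g \<union> E (Suc m) \<omega>) \<in> space (F (Suc m)) \<rightarrow> all_graphs"
      using that E_subset by force
    fix h
    have "E (Suc m) -` {e. g \<union> e = h} \<inter> space (F (Suc m)) \<in> sets (F (Suc m))"
      by (rule measurable_sets[OF E_meas]) simp
    then show "(\<lambda>\<omega>. g \<union> E (Suc m) \<omega>) -` {h} \<inter> space (F (Suc m)) \<in> sets (F (Suc m))"
      by (simp add: vimage_def)
  qed
  have "(\<lambda>\<omega>. G m \<omega> \<union> E (Suc m) \<omega>) \<in> measurable (F (Suc m)) (count_space all_graphs)"
    by (rule measurable_compose_countable'[OF 2 1]) (auto intro: countable_finite)
  then show ?case by (simp add: graph_at_Suc[abs_def])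
qed

section \<open>Events determined by the graphs\<close>

lemma G_event_F: "m \<le> j \<Longrightarrow> {\<omega>\<in>space M. Q (G m \<omega>)} \<in> sets (F j)"
proof -
  assume "m \<le> j"
  have "G m -` {g\<in>all_graphs. Q g} \<inter> space (F m) \<in> sets (F m)"
    by (rule measurable_sets[OF G_measurable]) auto
  moreover have "G m -` {g\<in>all_graphs. Q g} \<inter> space (F m) = {\<omega>\<in>space M. Q (G m \<omega>)}"
    using G_subset by auto
  ultimately show ?thesis using F_mono[OF \<open>m \<le> j\<close>] by auto
qed

lemma G_event: "{\<omega>\<in>space M. Q (G m \<omega>)} \<in> events"
  using G_event_F[of m m Q] F_sub by blast

lemma G_measurable_M: "G m \<in> measurable M (count_space all_graphs)"
proof -
  have "measurable (F m) (count_space all_graphs) \<subseteq> measurable M (count_space all_graphs)"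
    by (rule measurable_mono) (use F_sub in auto)
  then show ?thesis using G_measurable by blast
qed

lemma integrable_event: "D \<in> events \<Longrightarrow> integrable M (indicator D :: 'a \<Rightarrow> real)"
  by (auto intro!: integrable_real_indicator simp: emeasure_eq_measure)

lemma G_fun_measurable [measurable]: "(\<lambda>\<omega>. f (G m \<omega>)) \<in> measurable M borel"
  by (rule measurable_compose[OF G_measurable_M]) simp

lemma G_event2: "{\<omega>\<in>space M. Q (G m \<omega>) (G m' \<omega>)} \<in> events"
proof -
  have "{\<omega>\<in>space M. Q (G m \<omega>) (G m' \<omega>)} =
    (\<Union>g\<in>all_graphs. {\<omega>\<in>space M. G m \<omega> = g} \<inter> {\<omega>\<in>space M. Q g (G m' \<omega>)})"
    using G_subset by auto
  also have "\<dots> \<in> events" using G_event by (intro sets.finite_UN sets.Int) auto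
  finally show ?thesis .
qed

lemma prob_split:
  assumes "B \<in> events"
  shows "prob (B \<inter> {\<omega>\<in>space M. Q (G m \<omega>)}) =
    (\<Sum>g\<in>{g\<in>all_graphs. Q g}. prob (B \<inter> {\<omega>\<in>space M. G m \<omega> = g}))"
proof -
  have "B \<inter> {\<omega>\<in>space M. Q (G m \<omega>)} =
      (\<Union>g\<in>{g\<in>all_graphs. Q g}. B \<inter> {\<omega>\<in>space M. G m \<omega> = g})"
    using G_subset by auto
  then show ?thesis
    using assms G_event
    by (subst finite_measure_finite_Union[symmetric]) (auto simp: disjoint_family_on_def)
qed

text \<open>Only finitely many graphs are possible, so a lower bound for a conditional probability
  can be checked for each value of \<open>G m\<close> separately and then summed.\<close>

lemma prob_cond_graph_lower:
  assumes "A \<in> events" "D \<in> events"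
    and "\<And>g. Q g \<Longrightarrow> p * prob (A \<inter> {\<omega>\<in>space M. G m \<omega> = g}) \<le>
           prob (A \<inter> {\<omega>\<in>space M. G m \<omega> = g} \<inter> D)"
  shows "p * prob (A \<inter> {\<omega>\<in>space M. Q (G m \<omega>)}) \<le> prob (A \<inter> {\<omega>\<in>space M. Q (G m \<omega>)} \<inter> D)"
proof -
  have "p * prob (A \<inter> {\<omega>\<in>space M. Q (G m \<omega>)}) =
      (\<Sum>g\<in>{g\<in>all_graphs. Q g}. p * prob (A \<inter> {\<omega>\<in>space M. G m \<omega> = g}))"
    by (simp add: prob_split[OF assms(1)] sum_distrib_left)
  also have "\<dots> \<le> (\<Sum>g\<in>{g\<in>all_graphs. Q g}. prob (A \<inter> D \<inter> {\<omega>\<in>space M. G m \<omega> = g}))"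
    using assms(3) by (intro sum_mono) (auto simp: Int_ac)
  also have "\<dots> = prob (A \<inter> D \<inter> {\<omega>\<in>space M. Q (G m \<omega>)})"
    using assms(1,2) by (subst prob_split) auto
  finally show ?thesis by (simp add: Int_ac)
qed

section \<open>Uniform vertex choices and the counting of merging steps\<close>

lemma v_event_F: "{\<omega>\<in>space M. v (Suc m) \<omega> \<in> S} \<in> sets (F (Suc m))"
  using measurable_sets[OF v_meas, of S m] by (simp add: vimage_def Int_def conj_commute)

lemma v_event: "{\<omega>\<in>space M. v (Suc m) \<omega> \<in> S} \<in> events"
  using v_event_F F_sub by blast

lemma v_prob:
  assumes "A \<in> sets (F m)" "S \<subseteq> {xs. set xs \<subseteq> {..<n} \<and> length xs = l}"
  shows "prob (A \<inter> {\<omega>\<in>space M. v (Suc m) \<omega> \<in> S}) = card S / real n ^ l * prob A"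
proof -
  have fin: "finite S" using finite_subset[OF assms(2)] finite_lists_length_eq[of "{..<n}" l] by simp
  have A: "A \<in> events" using assms(1) F_sub by blast
  have "A \<inter> {\<omega>\<in>space M. v (Suc m) \<omega> \<in> S} = (\<Union>xs\<in>S. A \<inter> {\<omega>\<in>space M. v (Suc m) \<omega> = xs})"
    by auto
  also have "prob \<dots> = (\<Sum>xs\<in>S. prob (A \<inter> {\<omega>\<in>space M. v (Suc m) \<omega> = xs}))"
    using fin A v_event[of m "{_}"]
    by (intro finite_measure_finite_Union) (auto simp: disjoint_family_on_def)
  also have "\<dots> = (\<Sum>xs\<in>S. prob A / real n ^ l)"
    using assms by (intro sum.cong v_unif) auto
  finally show ?thesis by simp
qed

text \<open>The number of components meeting \<open>W\<close> starts at no more than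
  \<open>R\<close> and never increases, so it drops at most \<open>R\<close> times. On the other
  hand, while \<open>Q\<close> holds, each step makes it drop with probability at least
  \<open>p\<close>. Comparing expected numbers of drops limits the probability that \<open>Q\<close>
  lasts from \<open>m\<close> to \<open>m'\<close>.\<close>

lemma drop_bound:
  fixes R p :: real
  assumes A: "A \<in> sets (F m)" and W: "W \<subseteq> {..<n}" and p: "0 \<le> p"
    and R: "\<And>\<omega>. \<omega> \<in> A \<Longrightarrow> card (comp n (G m \<omega>) ` W) \<le> R"
    and Q: "\<And>g g'. g \<subseteq> g' \<Longrightarrow> Q g' \<Longrightarrow> Q g"
    and step: "\<And>j. m \<le> j \<Longrightarrow> p * prob (A \<inter> {\<omega>\<in>space M. Q (G j \<omega>)}) \<le>
       prob (A \<inter> {\<omega>\<in>space M. Q (G j \<omega>)} \<inter>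
         {\<omega>\<in>space M. card (comp n (G (Suc j) \<omega>) ` W) < card (comp n (G j \<omega>) ` W)})"
    and "m \<le> m'"
  shows "real (m' - m) * p * prob (A \<inter> {\<omega>\<in>space M. Q (G m' \<omega>)}) \<le> R * prob A"
proof -
  define Z where "Z j \<omega> = card (comp n (G j \<omega>) ` W)" for j \<omega>
  define D where "D j = A \<inter> {\<omega>\<in>space M. Z (Suc j) \<omega> < Z j \<omega>}" for j
  have AE: "A \<in> events" using A F_sub by blast
  have DE: "D j \<in> events" for j
    unfolding D_def Z_def
    using AE G_event2[of "\<lambda>h g. card (comp n g ` W) < card (comp n h ` W)" j "Suc j"] by auto
  \<comment> \<open>\<open>Q\<close> passes to subgraphs, so if it holds at time \<open>m'\<close>
    then it has held at every earlier time \<open>j\<close>.\<close>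
  have pD: "p * prob (A \<inter> {\<omega>\<in>space M. Q (G m' \<omega>)}) \<le> prob (D j)" if "j \<in> {m..<m'}" for j
  proof -
    have "prob (A \<inter> {\<omega>\<in>space M. Q (G m' \<omega>)}) \<le> prob (A \<inter> {\<omega>\<in>space M. Q (G j \<omega>)})"
      using that AE G_event by (intro finite_measure_mono) (auto intro: Q[OF graph_at_mono, of j m'])
    then have "p * prob (A \<inter> {\<omega>\<in>space M. Q (G m' \<omega>)}) \<le> p * prob (A \<inter> {\<omega>\<in>space M. Q (G j \<omega>)})"
      using p by (rule mult_left_mono)
    also have "\<dots> \<le> prob (A \<inter> {\<omega>\<in>space M. Q (G j \<omega>)} \<inter>
         {\<omega>\<in>space M. card (comp n (G (Suc j) \<omega>) ` W) < card (comp n (G j \<omega>) ` W)})"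
      using that by (intro step) auto
    also have "\<dots> \<le> prob (D j)"
      using DE by (intro finite_measure_mono) (auto simp: D_def Z_def)
    finally show ?thesis .
  qed
  \<comment> \<open>Each drop lowers \<open>Z\<close> by at least one, and \<open>Z\<close> is
    nonincreasing in time.\<close>
  have tele: "(\<Sum>j\<in>{m..<m+i}. indicator (D j) \<omega>) + real (Z (m + i) \<omega>) \<le> Z m \<omega>"
    if "\<omega> \<in> A" for i \<omega>
  proof (induction i)
    case (Suc i)
    have "Z (Suc (m + i)) \<omega> \<le> Z (m + i) \<omega>"
      unfolding Z_def using W by (intro card_comp_image_mono graph_at_mono) auto
    then have "indicator (D (m + i)) \<omega> + real (Z (Suc (m + i)) \<omega>) \<le> Z (m + i) \<omega>"
      by (auto simp: D_def indicator_def)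
    then show ?case using Suc by simp
  qed simp
  have "real (m' - m) * p * prob (A \<inter> {\<omega>\<in>space M. Q (G m' \<omega>)})
      = (\<Sum>j\<in>{m..<m'}. p * prob (A \<inter> {\<omega>\<in>space M. Q (G m' \<omega>)}))" by simp
  also have "\<dots> \<le> (\<Sum>j\<in>{m..<m'}. prob (D j))" by (intro sum_mono pD)
  also have "\<dots> = expectation (\<lambda>\<omega>. \<Sum>j\<in>{m..<m'}. indicator (D j) \<omega>)"
    using DE by (subst Bochner_Integration.integral_sum) (auto intro: integrable_event)
  also have "\<dots> \<le> expectation (\<lambda>\<omega>. R * indicator A \<omega>)"
  proof (rule integral_mono)
    fix \<omega>
    show "(\<Sum>j\<in>{m..<m'}. indicator (D j) \<omega>) \<le> R * indicator A \<omega>"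
    proof (cases "\<omega> \<in> A")
      case True
      then show ?thesis using tele[OF True, of "m' - m"] R[OF True] \<open>m \<le> m'\<close> by (simp add: Z_def)
    next
      case False
      then show ?thesis by (simp add: D_def)
    qed
  qed (use DE AE in \<open>auto intro!: integrable_event Bochner_Integration.integrable_sum
    integrable_mult_right\<close>)
  also have "\<dots> = R * prob A" using AE by simp
  finally show ?thesis .
qed

text \<open>Condition (iii) of a vertex rule forces an edge. Its ends are entries of
  \<open>xs\<close>, so they lie in \<open>W\<close> and belonged to different components
  before.\<close>

lemma all_separated_merge:
  assumes "\<omega> \<in> space M" "v (Suc j) \<omega> = xs" "set xs \<subseteq> W" "W \<subseteq> {..<n}"
    and "distinct (map (comp n (G j \<omega>)) xs)"
  shows "card (comp n (G (Suc j) \<omega>) ` W) < card (comp n (G j \<omega>) ` W)"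
proof -
  have len: "length xs = l" "set xs \<subseteq> {..<n}" using v_range[OF assms(1), of j] assms(2) by auto
  have sep: "\<not> conn n (G j \<omega>) (xs ! i) (xs ! i')" if "i < l" "i' < l" "i \<noteq> i'" for i i'
  proof -
    have "comp n (G j \<omega>) (xs ! i) \<noteq> comp n (G j \<omega>) (xs ! i')"
      using assms(5) that len unfolding distinct_conv_nth by auto
    then show ?thesis using comp_cong_conn by blast
  qed
  then have "E (Suc j) \<omega> \<noteq> {}" using assms(1,2) by (intro E_nonempty) auto
  then obtain a b where ab: "(a, b) \<in> E (Suc j) \<omega>" by auto
  then have ab': "a \<noteq> b" "a \<in> set xs" "b \<in> set xs" using E_range[OF assms(1) ab] assms(2) by auto
  then obtain i i' where "i < l" "i' < l" "a = xs ! i" "b = xs ! i'"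
    using len by (auto simp: in_set_conv_nth)
  then have "\<not> conn n (G j \<omega>) a b" using sep ab'(1) by auto
  moreover have "conn n (G (Suc j) \<omega>) a b"
    using ab ab' len by (intro conn_edge) (auto simp: graph_at_Suc)
  ultimately show ?thesis
    using ab' assms(3,4) by (intro card_comp_image_less[of _ _ _ _ a b]) (auto simp: graph_at_Suc)
qed

text \<open>This reduces a bound to the case of a fixed graph at time \<open>m\<close>; a vertex set
  defined through that graph is then deterministic, as \<open>drop_bound\<close> demands.\<close>

lemma prob_sum_over_graph:
  assumes "\<And>g. c * prob ({\<omega>\<in>space M. G m \<omega> = g} \<inter> {\<omega>\<in>space M. P g (G m' \<omega>)}) \<le>
    R * prob {\<omega>\<in>space M. G m \<omega> = g}"
  shows "c * prob {\<omega>\<in>space M. P (G m \<omega>) (G m' \<omega>)} \<le> R"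
proof -
  let ?B = "{\<omega>\<in>space M. P (G m \<omega>) (G m' \<omega>)}"
  have "?B \<inter> {\<omega>\<in>space M. G m \<omega> = g} = {\<omega>\<in>space M. G m \<omega> = g} \<inter> {\<omega>\<in>space M. P g (G m' \<omega>)}" for g
    by auto
  with prob_split[of ?B "\<lambda>_. True" m] G_event2[of P m m']
  have "c * prob ?B =
      (\<Sum>g\<in>all_graphs. c * prob ({\<omega>\<in>space M. G m \<omega> = g} \<inter> {\<omega>\<in>space M. P g (G m' \<omega>)}))"
    by (simp add: sum_distrib_left Int_def conj_ac Pow_def)
  also have "\<dots> \<le> (\<Sum>g\<in>all_graphs. R * prob {\<omega>\<in>space M. G m \<omega> = g})"
    by (intro sum_mono assms)
  also have "\<dots> = R * prob (space M)"
    using prob_split[of "space M" "\<lambda>_. True" m] by (simp add: sum_distrib_left Int_def Pow_def)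
  finally show ?thesis by (simp add: prob_space)
qed

text \<open>An application of \<open>drop_bound\<close> to the set \<open>W\<close> of vertices in
  components larger than \<open>K\<close> at time \<open>m\<close>, with \<open>R = n / K\<close>.
  The property \<open>Q\<close> says that the set \<open>U\<close> of those vertices still below the
  linear threshold has at least \<open>\<epsilon> * n\<close> elements; \<open>U\<close> can only
  shrink as the graph grows.\<close>

lemma few_vertices_in_intermediate_components:
  fixes \<epsilon> :: real and K :: nat
  assumes "0 < \<epsilon>" "1 \<le> K" "1 \<le> l" "m \<le> m'"
  shows "real (m' - m) * (\<epsilon> / 2) ^ l * prob {\<omega>\<in>space M. \<epsilon> * n \<le>
      card {x. x < n \<and> K < card (comp n (G m \<omega>) x) \<and> card (comp n (G m' \<omega>) x) < \<epsilon> / (2 * l) * n}}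
    \<le> n / K"
proof (rule prob_sum_over_graph)
  fix g
  define W where "W = {x. x < n \<and> K < card (comp n g x)}"
  define U where "U h = {x\<in>W. card (comp n h x) < \<epsilon> / (2 * l) * n}" for h
  let ?A = "{\<omega>\<in>space M. G m \<omega> = g}"
  have W: "W \<subseteq> {..<n}" by (auto simp: W_def)
  have U: "U h \<subseteq> {..<n}" for h using W by (auto simp: U_def)
  have AF: "?A \<in> sets (F j)" if "m \<le> j" for j using G_event_F[OF that] .
  have "real (m' - m) * (\<epsilon> / 2) ^ l * prob (?A \<inter> {\<omega>\<in>space M. \<epsilon> * n \<le> card (U (G m' \<omega>))})
      \<le> n / K * prob ?A"
  proof (rule drop_bound[OF AF W _ _ _ _ \<open>m \<le> m'\<close>])
    fix \<omega> assume "\<omega> \<in> ?A"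
    then have "real K * card (comp n (G m \<omega>) ` W) \<le> n"
      by (intro card_comp_image_bound[OF W]) (auto simp: W_def)
    then show "card (comp n (G m \<omega>) ` W) \<le> real n / real K"
      using assms(2) by (simp add: field_simps)
  next
    fix h h' :: "(nat \<times> nat) set" assume h: "h \<subseteq> h'" "\<epsilon> * n \<le> card (U h')"
    have "U h' \<subseteq> U h"
      using card_comp_mono[OF h(1), of n] by (auto simp: U_def intro: le_less_trans[rotated])
    then have "card (U h') \<le> card (U h)"
      using finite_subset[OF U] by (intro card_mono) auto
    with h(2) show "\<epsilon> * n \<le> card (U h)" by linarith
  next
    fix j assume "m \<le> j"
    let ?D = "{\<omega>\<in>space M. card (comp n (G (Suc j) \<omega>) ` W) < card (comp n (G j \<omega>) ` W)}"
    have DE: "?D \<in> events"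
      using G_event2[of "\<lambda>g h. card (comp n h ` W) < card (comp n g ` W)" j "Suc j"] .
    show "(\<epsilon> / 2) ^ l * prob (?A \<inter> {\<omega>\<in>space M. \<epsilon> * n \<le> card (U (G j \<omega>))})
        \<le> prob (?A \<inter> {\<omega>\<in>space M. \<epsilon> * n \<le> card (U (G j \<omega>))} \<inter> ?D)"
    proof (rule prob_cond_graph_lower[OF G_event DE])
      fix h assume h: "\<epsilon> * n \<le> card (U h)"
      let ?B = "?A \<inter> {\<omega>\<in>space M. G j \<omega> = h}"
      define S where "S = {xs. length xs = l \<and> set xs \<subseteq> U h \<and> distinct (map (comp n h) xs)}"
      have BF: "?B \<in> sets (F j)" using AF[OF \<open>m \<le> j\<close>] G_event_F[of j j] by auto
      \<comment> \<open>The threshold \<open>\<epsilon> / (2 * l) * n\<close> is made for this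
        count: \<open>l\<close> components below it cover at most \<open>\<epsilon> * n / 2\<close>
        vertices, so each of the \<open>l\<close> entries has at least
        \<open>\<epsilon> * n / 2\<close> choices in \<open>U h\<close>.\<close>
      have "(\<epsilon> * n / 2) ^ l \<le> card S"
        unfolding S_def
      proof (rule card_separated_lists[OF U])
        show "\<epsilon> * n / 2 + l * (\<epsilon> / (2 * l) * n) \<le> card (U h)"
          using h assms(3) by (simp add: field_simps)
      qed (use assms in \<open>auto simp: U_def\<close>)
      then have "(\<epsilon> / 2) ^ l \<le> card S / real n ^ l"
        using n_pos by (simp add: field_simps power_mult_distrib power_divide)
      then have "(\<epsilon> / 2) ^ l * prob ?B \<le> card S / real n ^ l * prob ?B"
        by (rule mult_right_mono) simp
      also have "\<dots> = prob (?B \<inter> {\<omega>\<in>space M. v (Suc j) \<omega> \<in> S})"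
        by (rule v_prob[OF BF, symmetric]) (use U in \<open>auto simp: S_def\<close>)
      also have "\<dots> \<le> prob (?B \<inter> ?D)"
      proof (rule finite_measure_mono)
        show "?B \<inter> {\<omega>\<in>space M. v (Suc j) \<omega> \<in> S} \<subseteq> ?B \<inter> ?D"
          using all_separated_merge[OF _ refl _ W, of _ j] by (auto simp: S_def U_def)
        show "?B \<inter> ?D \<in> events" using DE G_event by auto
      qed
      finally show "(\<epsilon> / 2) ^ l * prob ?B \<le> prob (?B \<inter> ?D)" .
    qed
  qed (use assms in auto)
  moreover have "U h = {x. x < n \<and> K < card (comp n g x) \<and> card (comp n h x) < \<epsilon> / (2 * l) * n}"
    for h by (auto simp: U_def W_def)
  ultimately show "real (m' - m) * (\<epsilon> / 2) ^ l * prob (?A \<inter> {\<omega>\<in>space M. \<epsilon> * n \<le>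
      card {x. x < n \<and> K < card (comp n g x) \<and> card (comp n (G m' \<omega>) x) < \<epsilon> / (2 * l) * n}})
    \<le> n / K * prob ?A" by simp
qed

text \<open>A component of size \<open>c \<le> K\<close> is missed by all \<open>l\<close> chosen
  vertices with probability \<open>(1 - c / n) ^ l\<close>, which is at least
  \<open>1 - l * K / n\<close> by Bernoulli's inequality; a missed component does not
  change.\<close>

lemma prob_size_in_Suc:
  assumes "I \<subseteq> {..K}" "x < n"
  shows "(1 - l * K / n) * prob {\<omega>\<in>space M. card (comp n (G j \<omega>) x) \<in> I} \<le>
    prob {\<omega>\<in>space M. card (comp n (G (Suc j) \<omega>) x) \<in> I}"
proof -
  let ?D = "{\<omega>\<in>space M. card (comp n (G (Suc j) \<omega>) x) \<in> I}"
  have DE: "?D \<in> events" by (rule G_event)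
  have "(1 - l * K / n) * prob (space M \<inter> {\<omega>\<in>space M. card (comp n (G j \<omega>) x) \<in> I})
      \<le> prob (space M \<inter> {\<omega>\<in>space M. card (comp n (G j \<omega>) x) \<in> I} \<inter> ?D)"
  proof (rule prob_cond_graph_lower[OF _ DE])
    fix h assume h: "card (comp n h x) \<in> I"
    let ?B = "space M \<inter> {\<omega>\<in>space M. G j \<omega> = h}"
    let ?c = "card (comp n h x)"
    define S where "S = {xs. set xs \<subseteq> {..<n} - comp n h x \<and> length xs = l}"
    have BF: "?B \<in> sets (F j)"
      using G_event_F[of j j "\<lambda>g. g = h"] by (simp add: Int_def conj_ac)
    have c: "?c \<le> n" "?c \<le> K" using card_comp_le h assms(1) by auto
    have "card S = card ({..<n} - comp n h x) ^ l"
      unfolding S_def by (rule card_lists_length_eq) simp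
    also have "card ({..<n} - comp n h x) = n - ?c"
      by (subst card_Diff_subset) (auto simp: comp_subset)
    finally have "card S / real n ^ l = ((n - ?c) / n) ^ l"
      using c by (simp add: power_divide)
    also have "(n - ?c) / n = 1 + (- (?c / n))" using n_pos c(1) by (simp add: field_simps)
    finally have S: "card S / real n ^ l = (1 + (- (?c / n))) ^ l" .
    have "real l * (?c / n) \<le> real l * (K / n)"
      using c by (intro mult_left_mono divide_right_mono) auto
    then have "1 - l * K / n \<le> 1 + real l * (- (?c / n))" by simp
    also have "\<dots> \<le> (1 + (- (?c / n))) ^ l"
      using c n_pos by (intro Bernoulli_inequality) (simp add: field_simps)
    finally have "1 - l * K / n \<le> card S / real n ^ l" using S by simp
    then have "(1 - l * K / n) * prob ?B \<le> card S / real n ^ l * prob ?B"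
      by (rule mult_right_mono) simp
    also have "\<dots> = prob (?B \<inter> {\<omega>\<in>space M. v (Suc j) \<omega> \<in> S})"
      by (rule v_prob[OF BF, symmetric]) (auto simp: S_def)
    also have "\<dots> \<le> prob (?B \<inter> ?D)"
    proof (rule finite_measure_mono)
      show "?B \<inter> ?D \<in> events" using BF F_sub DE by blast
      show "?B \<inter> {\<omega>\<in>space M. v (Suc j) \<omega> \<in> S} \<subseteq> ?B \<inter> ?D"
      proof
        fix \<omega> assume "\<omega> \<in> ?B \<inter> {\<omega>\<in>space M. v (Suc j) \<omega> \<in> S}"
        then have \<omega>: "\<omega> \<in> space M" "G j \<omega> = h" "set (v (Suc j) \<omega>) \<inter> comp n h x = {}"
          by (auto simp: S_def)
        have "comp n (h \<union> E (Suc j) \<omega>) x = comp n h x"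
          using \<omega>(3) E_range[OF \<omega>(1)] assms(2) by (intro comp_Un_untouched) blast+
        then show "\<omega> \<in> ?B \<inter> ?D" using \<omega> h by (simp add: graph_at_Suc)
      qed
    qed
    finally show "(1 - l * K / n) * prob ?B \<le> prob (?B \<inter> ?D)" .
  qed auto
  also have "\<dots> \<le> prob ?D" by (rule finite_measure_mono[OF _ DE]) auto
  finally show ?thesis by (simp add: Int_def conj_ac)
qed

lemma prob_size_in:
  assumes "I \<subseteq> {..K}" "x < n" "l * K \<le> n"
  shows "(1 - l * K / n) ^ i * prob {\<omega>\<in>space M. card (comp n (G j \<omega>) x) \<in> I} \<le>
    prob {\<omega>\<in>space M. card (comp n (G (j + i) \<omega>) x) \<in> I}"
proof (induction i)
  case (Suc i)
  have "0 \<le> 1 - l * K / n"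
    using assms(3) n_pos by (simp add: field_simps flip: of_nat_mult)
  from mult_left_mono[OF Suc this] prob_size_in_Suc[OF assms(1,2), of "j + i"]
  show ?case by (simp add: mult.assoc)
qed simp

lemma integrable_G_fun:
  fixes f :: "(nat \<times> nat) set \<Rightarrow> real"
  shows "integrable M (\<lambda>\<omega>. f (G m \<omega>))"
proof (rule integrable_const_bound[where B = "Max ((\<lambda>g. \<bar>f g\<bar>) ` all_graphs)"])
  show "AE \<omega> in M. norm (f (G m \<omega>)) \<le> Max ((\<lambda>g. \<bar>f g\<bar>) ` all_graphs)"
    using G_subset by (intro AE_I2) (auto intro!: Max_ge)
qed measurable

lemma expectation_card_size_in:
  "expectation (\<lambda>\<omega>. real (card {x. x < n \<and> card (comp n (G m \<omega>) x) \<in> I})) =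
    (\<Sum>x<n. prob {\<omega>\<in>space M. card (comp n (G m \<omega>) x) \<in> I})"
proof -
  have "expectation (\<lambda>\<omega>. real (card {x. x < n \<and> card (comp n (G m \<omega>) x) \<in> I})) =
    expectation (\<lambda>\<omega>. \<Sum>x<n. indicator {\<omega>\<in>space M. card (comp n (G m \<omega>) x) \<in> I} \<omega>)"
  proof (rule Bochner_Integration.integral_cong[OF refl])
    fix \<omega> assume "\<omega> \<in> space M"
    then show "real (card {x. x < n \<and> card (comp n (G m \<omega>) x) \<in> I}) =
      (\<Sum>x<n. indicator {\<omega>\<in>space M. card (comp n (G m \<omega>) x) \<in> I} \<omega>)"
      by (simp add: indicator_def sum.If_cases Int_def conj_ac lessThan_def)
  qed
  also have "\<dots> = (\<Sum>x<n. prob {\<omega>\<in>space M. card (comp n (G m \<omega>) x) \<in> I})"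
    using G_event[of "\<lambda>g. card (comp n g _) \<in> I" m]
    by (subst Bochner_Integration.integral_sum) (auto intro!: integrable_event)
  finally show ?thesis .
qed

text \<open>Linearity of expectation turns survival of the size class for each single vertex into
  survival of its expected number of vertices, without any independence between vertices.\<close>

lemma expectation_card_size_in_decay:
  assumes "I \<subseteq> {..K}" "l * K \<le> n"
  shows "(1 - l * K / n) ^ i * expectation (\<lambda>\<omega>. real (card {x. x < n \<and> card (comp n (G j \<omega>) x) \<in> I}))
    \<le> expectation (\<lambda>\<omega>. real (card {x. x < n \<and> card (comp n (G (j + i) \<omega>) x) \<in> I}))"
  unfolding expectation_card_size_in sum_distrib_left
  using assms by (intro sum_mono prob_size_in) auto

end

locale merging_process = vertex_process +
  assumes merge: "0 < (\<beta> :: real) \<Longrightarrow> C \<noteq> C' \<Longrightarrow> \<beta> * n \<le> card C \<Longrightarrow> \<beta> * n \<le> card C' \<Longrightarrow> A \<in> sets (F m) \<Longrightarrow>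
    A \<subseteq> {\<omega> \<in> space M. C \<in> components n (graph_at E m \<omega>) \<and> C' \<in> components n (graph_at E m \<omega>)} \<Longrightarrow>
    \<beta> ^ l * prob A \<le>
      prob (A \<inter> {\<omega> \<in> space M. \<exists>x\<in>C. \<exists>y\<in>C'. conn n (graph_at E (Suc m) \<omega>) x y})"
begin

text \<open>Again \<open>drop_bound\<close>, now for the vertices \<open>W\<close> in components of
  size at least \<open>\<beta> * n\<close> at time \<open>m\<close>, with
  \<open>R = 1 / \<beta>\<close>. As long as \<open>W\<close> meets two components, the merging
  property joins them with probability at least \<open>\<beta> ^ l\<close> in each step.\<close>

lemma large_components_merge:
  fixes \<beta> :: real
  assumes "0 < \<beta>" "m \<le> m'"
  shows "real (m' - m) * \<beta> ^ l * prob {\<omega>\<in>space M. \<exists>x<n. \<exists>y<n.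
      \<beta> * n \<le> card (comp n (G m \<omega>) x) \<and> \<beta> * n \<le> card (comp n (G m \<omega>) y) \<and>
      \<not> conn n (G m' \<omega>) x y} \<le> 1 / \<beta>"
proof (rule prob_sum_over_graph)
  fix g
  define W where "W = {x. x < n \<and> \<beta> * n \<le> card (comp n g x)}"
  let ?A = "{\<omega>\<in>space M. G m \<omega> = g}"
  have W: "W \<subseteq> {..<n}" by (auto simp: W_def)
  have AF: "?A \<in> sets (F j)" if "m \<le> j" for j using G_event_F[OF that] .
  have "real (m' - m) * \<beta> ^ l * prob (?A \<inter> {\<omega>\<in>space M. \<exists>x\<in>W. \<exists>y\<in>W. \<not> conn n (G m' \<omega>) x y})
      \<le> 1 / \<beta> * prob ?A"
  proof (rule drop_bound[OF AF W _ _ _ _ \<open>m \<le> m'\<close>])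
    fix \<omega> assume "\<omega> \<in> ?A"
    then have "(\<beta> * n) * card (comp n (G m \<omega>) ` W) \<le> n"
      by (intro card_comp_image_bound[OF W]) (auto simp: W_def)
    then show "card (comp n (G m \<omega>) ` W) \<le> 1 / \<beta>"
      using assms(1) n_pos by (simp add: field_simps)
  next
    fix h h' :: "(nat \<times> nat) set" assume "h \<subseteq> h'" "\<exists>x\<in>W. \<exists>y\<in>W. \<not> conn n h' x y"
    then show "\<exists>x\<in>W. \<exists>y\<in>W. \<not> conn n h x y" using conn_mono by blast
  next
    fix j assume "m \<le> j"
    let ?D = "{\<omega>\<in>space M. card (comp n (G (Suc j) \<omega>) ` W) < card (comp n (G j \<omega>) ` W)}"
    have DE: "?D \<in> events"
      using G_event2[of "\<lambda>g h. card (comp n h ` W) < card (comp n g ` W)" j "Suc j"] .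
    show "\<beta> ^ l * prob (?A \<inter> {\<omega>\<in>space M. \<exists>x\<in>W. \<exists>y\<in>W. \<not> conn n (G j \<omega>) x y})
        \<le> prob (?A \<inter> {\<omega>\<in>space M. \<exists>x\<in>W. \<exists>y\<in>W. \<not> conn n (G j \<omega>) x y} \<inter> ?D)"
    proof (rule prob_cond_graph_lower[OF G_event DE])
      fix h assume "\<exists>x\<in>W. \<exists>y\<in>W. \<not> conn n h x y"
      then obtain a b where ab: "a \<in> W" "b \<in> W" "\<not> conn n h a b" by blast
      let ?B = "?A \<inter> {\<omega>\<in>space M. G j \<omega> = h}"
      have BF: "?B \<in> sets (F j)" using AF[OF \<open>m \<le> j\<close>] G_event_F[of j j] by auto
      show "\<beta> ^ l * prob ?B \<le> prob (?B \<inter> ?D)"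
      \<comment> \<open>Only graphs \<open>h\<close> containing \<open>g\<close> can occur at time
        \<open>j\<close>; for these the components of vertices in \<open>W\<close> are still of size
        at least \<open>\<beta> * n\<close>.\<close>
      proof (cases "g \<subseteq> h")
        case False
        then have "?B = {}" using graph_at_mono[OF \<open>m \<le> j\<close>, of E] by blast
        then show ?thesis by simp
      next
        case True
        let ?C = "comp n h a" and ?C' = "comp n h b"
        have big: "\<beta> * n \<le> card (comp n h x)" if "x \<in> W" for x
        proof -
          have "\<beta> * n \<le> card (comp n g x)" using that by (simp add: W_def)
          also have "\<dots> \<le> card (comp n h x)" using card_comp_mono[OF True] by simp
          finally show ?thesis .
        qed
        have "\<beta> ^ l * prob ?B \<le>
            prob (?B \<inter> {\<omega> \<in> space M. \<exists>x\<in>?C. \<exists>y\<in>?C'. conn n (G (Suc j) \<omega>) x y})"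
        proof (rule merge[OF assms(1) _ _ _ BF])
          show "?C \<noteq> ?C'" using ab W comp_eq_iff by blast
        qed (use ab big W in \<open>auto simp: components_def\<close>)
        also have "\<dots> \<le> prob (?B \<inter> ?D)"
        proof (rule finite_measure_mono)
          show "?B \<inter> ?D \<in> events" using DE G_event by auto
          show "?B \<inter> {\<omega> \<in> space M. \<exists>x\<in>?C. \<exists>y\<in>?C'. conn n (G (Suc j) \<omega>) x y} \<subseteq> ?B \<inter> ?D"
          proof
            fix \<omega> assume "\<omega> \<in> ?B \<inter> {\<omega> \<in> space M. \<exists>x\<in>?C. \<exists>y\<in>?C'. conn n (G (Suc j) \<omega>) x y}"
            then obtain x y where \<omega>: "\<omega> \<in> ?B" "\<omega> \<in> space M" "G j \<omega> = h"
              and xy: "conn n h a x" "conn n h b y" "conn n (G (Suc j) \<omega>) x y"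
              by (auto simp: comp_def)
            have sub: "h \<subseteq> G (Suc j) \<omega>" using graph_at_mono[of j "Suc j" E \<omega>] \<omega>(3) by simp
            have "conn n (G (Suc j) \<omega>) a b"
              using conn_mono[OF xy(1) sub] conn_mono[OF xy(2) sub] xy(3)
              by (blast intro: conn_trans conn_sym)
            then have "card (comp n (G (Suc j) \<omega>) ` W) < card (comp n h ` W)"
              using sub W ab by (intro card_comp_image_less)
            then show "\<omega> \<in> ?B \<inter> ?D" using \<omega> by simp
          qed
        qed
        finally show ?thesis .
      qed
    qed
  qed (use assms in auto)
  moreover have "(\<exists>x\<in>W. \<exists>y\<in>W. \<not> conn n h x y) \<longleftrightarrow> (\<exists>x<n. \<exists>y<n. \<beta> * n \<le> card (comp n g x) \<and>
      \<beta> * n \<le> card (comp n g y) \<and> \<not> conn n h x y)" for h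
    by (auto simp: W_def)
  ultimately show "real (m' - m) * \<beta> ^ l * prob (?A \<inter> {\<omega>\<in>space M. \<exists>x<n. \<exists>y<n.
      \<beta> * n \<le> card (comp n g x) \<and> \<beta> * n \<le> card (comp n g y) \<and> \<not> conn n (G m' \<omega>) x y})
    \<le> 1 / \<beta> * prob ?A" by simp
qed

end

section \<open>Convergence in probability\<close>

text \<open>The index 0 is left out because a quotient by \<open>n\<close> has the default value 0
  there.\<close>

lemma conv_in_prob_const: "(\<And>n \<omega>. 1 \<le> n \<Longrightarrow> X n \<omega> = c) \<Longrightarrow> conv_in_prob M X c"
  unfolding conv_in_prob_def
  by (intro allI impI tendsto_eventually eventually_sequentiallyI[of 1]) simp

lemma conv_in_probD:
  "conv_in_prob M X c \<Longrightarrow> 0 < \<delta> \<Longrightarrow>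
    (\<lambda>n. measure (M n) {\<omega> \<in> space (M n). \<bar>X n \<omega> - c\<bar> > \<delta>}) \<longlonglongrightarrow> 0"
  by (simp add: conv_in_prob_def)

lemma conv_in_prob_eventually:
  "conv_in_prob M X c \<Longrightarrow> 0 < \<delta> \<Longrightarrow> 0 < \<eta> \<Longrightarrow>
    eventually (\<lambda>n. measure (M n) {\<omega> \<in> space (M n). \<bar>X n \<omega> - c\<bar> > \<delta>} < \<eta>) sequentially"
  by (rule order_tendstoD(2)[OF conv_in_probD])

lemma conv_in_prob_add:
  assumes prob: "\<And>n. 1 \<le> n \<Longrightarrow> prob_space (M n)"
    and [measurable]: "\<And>n. 1 \<le> n \<Longrightarrow> X n \<in> borel_measurable (M n)"
      "\<And>n. 1 \<le> n \<Longrightarrow> Y n \<in> borel_measurable (M n)"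
    and "conv_in_prob M X a" "conv_in_prob M Y b"
  shows "conv_in_prob M (\<lambda>n \<omega>. X n \<omega> + Y n \<omega>) (a + b)"
  unfolding conv_in_prob_def
proof (intro allI impI)
  fix \<delta> :: real assume "0 < \<delta>"
  let ?A = "\<lambda>n. {\<omega> \<in> space (M n). \<bar>X n \<omega> - a\<bar> > \<delta> / 2}"
    and ?B = "\<lambda>n. {\<omega> \<in> space (M n). \<bar>Y n \<omega> - b\<bar> > \<delta> / 2}"
    and ?C = "\<lambda>n. {\<omega> \<in> space (M n). \<bar>X n \<omega> + Y n \<omega> - (a + b)\<bar> > \<delta>}"
  have "(\<lambda>n. measure (M n) (?A n) + measure (M n) (?B n)) \<longlonglongrightarrow> 0 + 0"
    using \<open>0 < \<delta>\<close> by (intro tendsto_add conv_in_probD assms(4,5)) simp_all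
  moreover have "eventually (\<lambda>n. measure (M n) (?C n) \<le> measure (M n) (?A n) + measure (M n) (?B n))
    sequentially"
  proof (rule eventually_sequentiallyI)
    fix n :: nat assume n: "1 \<le> n"
    interpret prob_space "M n" using prob[OF n] .
    have X[measurable]: "X n \<in> borel_measurable (M n)" "Y n \<in> borel_measurable (M n)"
      using assms(2,3)[OF n] by auto
    have "prob (?C n) \<le> prob (?A n \<union> ?B n)"
      by (rule finite_measure_mono) (auto simp: abs_if split: if_splits)
    also have "\<dots> \<le> prob (?A n) + prob (?B n)"
      by (rule measure_Un_le) auto
    finally show "prob (?C n) \<le> prob (?A n) + prob (?B n)" .
  qed
  ultimately show "(\<lambda>n. measure (M n) (?C n)) \<longlonglongrightarrow> 0"
    using tendsto_sandwich[of "\<lambda>_. 0" "\<lambda>n. measure (M n) (?C n)" sequentially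
      "\<lambda>n. measure (M n) (?A n) + measure (M n) (?B n)" 0] by simp
qed

text \<open>For large \<open>n\<close> the event \<open>B n\<close> and the two deviation events
  have total probability below 1. Some outcome avoids all three, and one such outcome suffices to
  compare the two constants up to \<open>\<delta>\<close>.\<close>

lemma conv_in_prob_le:
  assumes prob: "\<And>n. 1 \<le> n \<Longrightarrow> prob_space (M n)"
    and mX: "\<And>n. 1 \<le> n \<Longrightarrow> X n \<in> borel_measurable (M n)"
    and mY: "\<And>n. 1 \<le> n \<Longrightarrow> Y n \<in> borel_measurable (M n)"
    and mB: "\<And>n. 1 \<le> n \<Longrightarrow> B n \<in> sets (M n)"
    and "conv_in_prob M X a" "conv_in_prob M Y b"
    and B: "eventually (\<lambda>n. measure (M n) (B n) \<le> 1 / 2) sequentially"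
    and le: "eventually (\<lambda>n. \<forall>\<omega>\<in>space (M n) - B n. X n \<omega> \<le> Y n \<omega> + e) sequentially"
  shows "a \<le> b + e"
proof (rule field_le_epsilon)
  fix \<delta> :: real assume \<delta>: "0 < \<delta>"
  let ?A = "\<lambda>n. {\<omega> \<in> space (M n). \<bar>X n \<omega> - a\<bar> > \<delta> / 2}"
    and ?C = "\<lambda>n. {\<omega> \<in> space (M n). \<bar>Y n \<omega> - b\<bar> > \<delta> / 2}"
  have "eventually (\<lambda>n. measure (M n) (?A n) < 1/4) sequentially"
    "eventually (\<lambda>n. measure (M n) (?C n) < 1/4) sequentially"
    using \<delta> by (intro conv_in_prob_eventually assms(5,6); simp)+
  with B le eventually_ge_at_top[of 1]
  have "eventually (\<lambda>n. a \<le> b + e + \<delta>) sequentially"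
  proof eventually_elim
    case (elim n)
    interpret prob_space "M n" using prob elim by simp
    have [measurable]: "X n \<in> borel_measurable (M n)" "Y n \<in> borel_measurable (M n)" "B n \<in> sets (M n)"
      using mX mY mB elim by auto
    have "prob (B n \<union> ?A n \<union> ?C n) \<le> prob (B n \<union> ?A n) + prob (?C n)"
      by (rule measure_Un_le) auto
    also have "prob (B n \<union> ?A n) \<le> prob (B n) + prob (?A n)"
      by (rule measure_Un_le) auto
    finally have "prob (B n \<union> ?A n \<union> ?C n) < 1" using elim by linarith
    then have "B n \<union> ?A n \<union> ?C n \<noteq> space (M n)" using prob_space by auto
    moreover have "B n \<subseteq> space (M n)" using sets.sets_into_space mB elim by blast
    ultimately obtain \<omega> where \<omega>: "\<omega> \<in> space (M n) - B n" "\<omega> \<notin> ?A n" "\<omega> \<notin> ?C n" by blast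
    then have "X n \<omega> \<le> Y n \<omega> + e" using elim by blast
    with \<omega> show ?case by (auto simp: abs_if split: if_splits)
  qed
  then show "a \<le> b + e + \<delta>" by (simp add: eventually_const)
qed

text \<open>The distance of \<open>X n\<close> from \<open>a\<close> is at most 1 on the deviation
  event, whose probability tends to 0, and at most \<open>e / 2\<close> off it.\<close>

lemma conv_in_prob_expectation:
  assumes prob: "\<And>n. 1 \<le> n \<Longrightarrow> prob_space (M n)"
    and mX: "\<And>n. 1 \<le> n \<Longrightarrow> X n \<in> borel_measurable (M n)"
    and X01: "\<And>n \<omega>. 1 \<le> n \<Longrightarrow> X n \<omega> \<in> {0..1}" and a: "a \<in> {0..1}"
    and "conv_in_prob M X a"
  shows "(\<lambda>n. integral\<^sup>L (M n) (X n)) \<longlonglongrightarrow> a"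
proof (rule LIMSEQ_I)
  fix e :: real assume e: "0 < e"
  let ?A = "\<lambda>n. {\<omega> \<in> space (M n). \<bar>X n \<omega> - a\<bar> > e / 2}"
  have "eventually (\<lambda>n. measure (M n) (?A n) < e / 2) sequentially"
    using e by (intro conv_in_prob_eventually assms(5)) simp_all
  with eventually_ge_at_top[of 1]
  have "eventually (\<lambda>n. norm (integral\<^sup>L (M n) (X n) - a) < e) sequentially"
  proof eventually_elim
    case (elim n)
    interpret prob_space "M n" using prob elim by simp
    have [measurable]: "X n \<in> borel_measurable (M n)" using mX elim by simp
    have bd: "0 \<le> X n \<omega>" "X n \<omega> \<le> 1" for \<omega> using X01[of n \<omega>] elim by auto
    have int: "integrable (M n) (X n)"
      by (rule integrable_const_bound[where B = 1]) (use bd in auto)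
    have ind: "integrable (M n) (indicator (?A n) :: 'a \<Rightarrow> real)"
      by (rule integrable_const_bound[where B = 1]) (auto simp: indicator_def)
    have "norm (integral\<^sup>L (M n) (X n) - a) = \<bar>integral\<^sup>L (M n) (\<lambda>\<omega>. X n \<omega> - a)\<bar>"
      using int by (simp add: prob_space)
    also have "\<dots> \<le> integral\<^sup>L (M n) (\<lambda>\<omega>. \<bar>X n \<omega> - a\<bar>)" by (rule integral_abs_bound)
    also have "\<dots> \<le> integral\<^sup>L (M n) (\<lambda>\<omega>. e / 2 + indicator (?A n) \<omega>)"
    proof (rule integral_mono)
      fix \<omega> assume "\<omega> \<in> space (M n)"
      then show "\<bar>X n \<omega> - a\<bar> \<le> e / 2 + indicator (?A n) \<omega>"
        using bd[of \<omega>] a e by (auto simp: indicator_def)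
    qed (use int ind in auto)
    also have "\<dots> = e / 2 + prob (?A n)" using ind by (simp add: prob_space)
    finally show ?case using elim by linarith
  qed
  then show "\<exists>N. \<forall>n\<ge>N. norm (integral\<^sup>L (M n) (X n) - a) < e"
    by (simp add: eventually_sequentially)
qed

section \<open>Small components\<close>

definition small :: "nat \<Rightarrow> (nat \<times> nat) set \<Rightarrow> nat \<Rightarrow> nat" where
  "small n g k = card {x. x < n \<and> card (comp n g x) \<le> k}"

lemma small_0 [simp]: "small n g 0 = 0"
  using comp_self[of _ n g] by (auto simp: small_def)

lemma small_Suc: "small n g (Suc k) = small n g k + Nk n g (Suc k)"
proof -
  have "{x. x < n \<and> card (comp n g x) \<le> Suc k} =
    {x. x < n \<and> card (comp n g x) \<le> k} \<union> {x. x < n \<and> card (comp n g x) = Suc k}" by auto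
  then show ?thesis unfolding small_def Nk_def by (simp add: card_Un_disjoint disjoint_iff)
qed

lemma small_le: "small n g k \<le> n"
proof -
  have "{x. x < n \<and> card (comp n g x) \<le> k} \<subseteq> {..<n}" by auto
  from card_mono[OF _ this] show ?thesis by (simp add: small_def)
qed

lemma small_antimono: "g \<subseteq> g' \<Longrightarrow> small n g' k \<le> small n g k"
  unfolding small_def
  using card_comp_mono[of g g' n] le_trans by (intro card_mono subsetI) (simp, blast)

lemma card_size_between:
  assumes "k \<le> K"
  shows "real (card {x. x < n \<and> card (comp n g x) \<in> {k<..K}}) = real (small n g K) - small n g k"
proof -
  have "{x. x < n \<and> card (comp n g x) \<le> K} =
    {x. x < n \<and> card (comp n g x) \<le> k} \<union> {x. x < n \<and> card (comp n g x) \<in> {k<..K}}"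
    using assms by auto
  then have "small n g K = small n g k + card {x. x < n \<and> card (comp n g x) \<in> {k<..K}}"
    unfolding small_def by (simp add: card_Un_disjoint disjoint_iff)
  then show ?thesis by simp
qed

lemma card_size_gt: "card {x. x < n \<and> k < card (comp n g x)} = n - small n g k"
proof -
  have "{x. x < n \<and> k < card (comp n g x)} = {..<n} - {x. x < n \<and> card (comp n g x) \<le> k}" by auto
  then show ?thesis unfolding small_def by (simp only:) (subst card_Diff_subset, auto)
qed

lemma card_comp_le_L1: "x < n \<Longrightarrow> card (comp n g x) \<le> L1 n g"
  unfolding L1_def by (rule Max_ge) auto

text \<open>If a largest component has more than \<open>k\<close> vertices, then all of its vertices
  are among the \<open>n - small n g k\<close> that lie in components of size above
  \<open>k\<close>.\<close>

lemma L1_le: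
  assumes "1 \<le> n" shows "L1 n g \<le> max k (n - small n g k)"
proof -
  have "L1 n g \<in> (\<lambda>x. card (comp n g x)) ` {..<n}"
    unfolding L1_def using assms by (intro Max_in) (auto simp: lessThan_empty_iff)
  then obtain x where x: "x < n" "L1 n g = card (comp n g x)" by auto
  show ?thesis
  proof (cases "card (comp n g x) \<le> k")
    case False
    then have "comp n g x \<subseteq> {y. y < n \<and> k < card (comp n g y)}"
      using comp_cong_conn[of n g x] by (auto simp: comp_def)
    then have "card (comp n g x) \<le> card {y. y < n \<and> k < card (comp n g y)}"
      by (intro card_mono) auto
    then show ?thesis using x card_size_gt by simp
  qed (use x in simp)
qed

text \<open>A step changes only components that contain a chosen vertex. The vertices that leave the
  small ones therefore lie in at most \<open>l\<close> components of size at most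
  \<open>k\<close>.\<close>

lemma (in vertex_process) small_decrease:
  assumes "\<omega> \<in> space M"
  shows "small n (G j \<omega>) k \<le> small n (G (j + i) \<omega>) k + l * k * i"
proof (induction i)
  case (Suc i)
  let ?g = "G (j + i) \<omega>" and ?V = "{y\<in>set (v (Suc (j + i)) \<omega>). card (comp n (G (j + i) \<omega>) y) \<le> k}"
  have sub: "{x. x < n \<and> card (comp n ?g x) \<le> k} \<subseteq>
      {x. x < n \<and> card (comp n (G (Suc (j + i)) \<omega>) x) \<le> k} \<union> (\<Union>y\<in>?V. comp n ?g y)"
  proof
    fix x assume x: "x \<in> {x. x < n \<and> card (comp n ?g x) \<le> k}"
    show "x \<in> {x. x < n \<and> card (comp n (G (Suc (j + i)) \<omega>) x) \<le> k} \<union> (\<Union>y\<in>?V. comp n ?g y)"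
    proof (cases "set (v (Suc (j + i)) \<omega>) \<inter> comp n ?g x = {}")
      case True
      then have "comp n (?g \<union> E (Suc (j + i)) \<omega>) x = comp n ?g x"
        using E_range[OF assms] x by (intro comp_Un_untouched) blast+
      then show ?thesis using x by (simp add: graph_at_Suc)
    next
      case False
      then obtain y where y: "y \<in> set (v (Suc (j + i)) \<omega>)" "conn n ?g x y" "y < n"
        by (auto simp: comp_def)
      then have "comp n ?g y = comp n ?g x" using comp_cong_conn by simp
      then have "y \<in> ?V" "x \<in> comp n ?g y" using x y comp_self[of x n ?g] by auto
      then show ?thesis by blast
    qed
  qed
  have "small n ?g k \<le> small n (G (Suc (j + i)) \<omega>) k + card (\<Union>y\<in>?V. comp n ?g y)"
    unfolding small_def by (rule order_trans[OF card_mono[OF _ sub] card_Un_le]) simp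
  also have "card (\<Union>y\<in>?V. comp n ?g y) \<le> (\<Sum>y\<in>?V. card (comp n ?g y))"
    by (rule card_UN_le) simp
  also have "\<dots> \<le> (\<Sum>y\<in>?V. k)" by (rule sum_mono) simp
  also have "\<dots> = card ?V * k" by simp
  also have "\<dots> \<le> l * k"
  proof (rule mult_right_mono)
    have "card ?V \<le> card (set (v (Suc (j + i)) \<omega>))" by (rule card_mono) auto
    also have "\<dots> \<le> l" using card_length v_range[OF assms] by metis
    finally show "card ?V \<le> l" .
  qed simp
  finally show ?case using Suc by simp
qed simp

section \<open>Limits\<close>

lemma nat_floor_diff_ge:
  fixes s u :: real assumes "0 \<le> s" "s \<le> u"
  shows "(u - s) * n - 1 \<le> real (nat \<lfloor>u * real n\<rfloor> - nat \<lfloor>s * real n\<rfloor>)"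
    and "real (nat \<lfloor>u * real n\<rfloor> - nat \<lfloor>s * real n\<rfloor>) \<le> (u - s) * n + 1"
    and "nat \<lfloor>s * real n\<rfloor> \<le> nat \<lfloor>u * real n\<rfloor>"
proof -
  have le: "s * n \<le> u * n" using assms by (intro mult_right_mono) auto
  have s: "0 \<le> \<lfloor>s * real n\<rfloor>" using assms by simp
  have fl: "\<lfloor>s * real n\<rfloor> \<le> \<lfloor>u * real n\<rfloor>" using le by (rule floor_mono)
  show *: "nat \<lfloor>s * real n\<rfloor> \<le> nat \<lfloor>u * real n\<rfloor>" using fl by (rule nat_mono)
  have "real (nat \<lfloor>u * real n\<rfloor> - nat \<lfloor>s * real n\<rfloor>) = real_of_int \<lfloor>u * real n\<rfloor> - real_of_int \<lfloor>s * real n\<rfloor>"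
    using * order_trans[OF s fl] s by (simp add: of_nat_diff del: zero_le_floor)
  moreover have "(u - s) * n = u * n - s * n" by (simp add: algebra_simps)
  ultimately show "(u - s) * n - 1 \<le> real (nat \<lfloor>u * real n\<rfloor> - nat \<lfloor>s * real n\<rfloor>)"
    "real (nat \<lfloor>u * real n\<rfloor> - nat \<lfloor>s * real n\<rfloor>) \<le> (u - s) * n + 1"
    by linarith+
qed

text \<open>Halving the time difference absorbs the rounding error once
  \<open>n \<ge> 2 / (u - s)\<close>.\<close>

lemma eventually_nat_floor_diff_ge:
  fixes s u :: real assumes "0 \<le> s" "s < u"
  shows "eventually (\<lambda>n. (u - s) / 2 * n \<le> real (nat \<lfloor>u * real n\<rfloor> - nat \<lfloor>s * real n\<rfloor>)) sequentially"
proof -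
  have "eventually (\<lambda>n. 2 / (u - s) \<le> real n) sequentially" by real_asymp
  then show ?thesis
  proof eventually_elim
    case (elim n)
    then have "1 \<le> (u - s) / 2 * n" using assms by (simp add: field_simps)
    then show ?case using nat_floor_diff_ge(1)[of s u n] assms by (simp add: field_simps)
  qed
qed

text \<open>This follows from \<open>exp (2 * x) \<ge> 1 + 2 * x\<close> and
  \<open>(1 - x) * (1 + 2 * x) = 1 + x * (1 - 2 * x) \<ge> 1\<close>.\<close>

lemma exp_le_one_minus:
  fixes x :: real assumes "0 \<le> x" "x \<le> 1 / 2"
  shows "exp (- (2 * x)) \<le> 1 - x"
proof -
  have "exp (- (2 * x)) = 1 / exp (2 * x)" by (simp add: exp_minus field_simps)
  also have "\<dots> \<le> 1 / (1 + 2 * x)"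
    using assms exp_ge_add_one_self[of "2 * x"] by (intro divide_left_mono) auto
  also have "\<dots> \<le> 1 - x"
  proof -
    have "0 \<le> x * (1 - 2 * x)" using assms by (intro mult_nonneg_nonneg) auto
    then show ?thesis using assms by (simp add: field_simps)
  qed
  finally show ?thesis .
qed

section \<open>Merging rules that are locally convergent\<close>

locale locally_convergent_rule =
  fixes l :: nat
    and M :: "nat \<Rightarrow> 'a measure" and F :: "nat \<Rightarrow> nat \<Rightarrow> 'a measure"
    and v :: "nat \<Rightarrow> nat \<Rightarrow> 'a \<Rightarrow> nat list" and E :: "nat \<Rightarrow> nat \<Rightarrow> 'a \<Rightarrow> (nat \<times> nat) set"
    and \<rho>k :: "nat \<Rightarrow> real \<Rightarrow> real"
  assumes l_ge: "l \<ge> 2"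
    and rule: "ell_vertex_rule l M F v E"
    and mergingE: "merging l M F E"
    and \<rho>k_bounds: "\<And>k t. t \<ge> 0 \<Longrightarrow> \<rho>k k t \<in> {0..1}"
    and local_conv: "\<And>k t. k \<ge> 1 \<Longrightarrow> t \<ge> 0 \<Longrightarrow>
           conv_in_prob M
             (\<lambda>n \<omega>. real (Nk n (graph_at (E n) (nat \<lfloor>t * real n\<rfloor>) \<omega>) k) / real n) (\<rho>k k t)"
begin

lemma merging_process: "1 \<le> n \<Longrightarrow> merging_process (M n) n l (F n) (v n) (E n)"
proof -
  assume n: "1 \<le> n"
  note c = rule[unfolded ell_vertex_rule_def, THEN spec, THEN mp, OF n]
  note r1 = conjunct1[OF c] and c1 = conjunct2[OF c]
  note r2 = conjunct1[OF c1] and c2 = conjunct2[OF c1]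
  note r3 = conjunct1[OF c2, rule_format] and c3 = conjunct2[OF c2]
  note r4 = conjunct1[OF c3, rule_format] and c4 = conjunct2[OF c3]
  note r5 = conjunct1[OF c4, rule_format] and c5 = conjunct2[OF c4]
  note r6 = conjunct1[OF c5, rule_format] and c6 = conjunct2[OF c5]
  note r7 = conjunct1[OF c6, rule_format] and c7 = conjunct2[OF c6]
  note r8 = conjunct1[OF c7, THEN spec, THEN mp, THEN bspec]
    and r9 = conjunct2[OF c7, THEN spec, THEN mp, THEN bspec, THEN mp]
  have mg: "\<epsilon> ^ l * measure (M n) A \<le> measure (M n) (A \<inter> {\<omega> \<in> space (M n).
      \<exists>x\<in>C. \<exists>y\<in>C'. conn n (graph_at (E n) (Suc m) \<omega>) x y})"
    if "0 < \<epsilon>" "C \<noteq> C'" "\<epsilon> * real n \<le> real (card C)" "\<epsilon> * real n \<le> real (card C')" "A \<in> sets (F n m)"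
      "A \<subseteq> {\<omega> \<in> space (M n). C \<in> components n (graph_at (E n) m \<omega>) \<and>
                              C' \<in> components n (graph_at (E n) m \<omega>)}" for \<epsilon> C C' A m
    using mergingE[unfolded merging_def, rule_format, of \<epsilon> n "Suc m" A C C'] that n by simp
  show ?thesis
  proof (intro merging_process.intro merging_process_axioms.intro vertex_process.intro
      vertex_process_axioms.intro r1 n r3)
    fix m
    show "sets (F n m) \<subseteq> sets (M n)" "space (F n m) = space (M n)" using r2 by auto
    show "v n (Suc m) \<in> measurable (F n (Suc m)) (count_space UNIV)" by (rule r4) simp
    show "length (v n (Suc m) \<omega>) = l \<and> set (v n (Suc m) \<omega>) \<subseteq> {..<n}" if "\<omega> \<in> space (M n)" for \<omega>
      by (rule r5) (simp_all add: that)
    show "measure (M n) (A \<inter> {\<omega> \<in> space (M n). v n (Suc m) \<omega> = xs}) = measure (M n) A / real n ^ l"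
      if "A \<in> sets (F n m)" "length xs = l" "set xs \<subseteq> {..<n}" for A xs
      by (rule r6) (simp_all add: that)
    show "E n (Suc m) \<in> measurable (F n (Suc m)) (count_space UNIV)" by (rule r7) simp
    show "a \<noteq> b \<and> a \<in> set (v n (Suc m) \<omega>) \<and> b \<in> set (v n (Suc m) \<omega>)"
      if "\<omega> \<in> space (M n)" "(a, b) \<in> E n (Suc m) \<omega>" for \<omega> a b
      using bspec[OF r8[of "Suc m" \<omega>] that(2)] that(1) by simp
    show "E n (Suc m) \<omega> \<noteq> {}"
      if "\<omega> \<in> space (M n)" "\<And>i j. i < l \<Longrightarrow> j < l \<Longrightarrow> i \<noteq> j \<Longrightarrow>
         \<not> conn n (graph_at (E n) m \<omega>) (v n (Suc m) \<omega> ! i) (v n (Suc m) \<omega> ! j)" for \<omega>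
      by (rule r9) (simp_all add: that)
  qed (rule mg)
qed

lemmas vertex_process = merging_process.axioms(1)[OF merging_process]
lemmas prob_space_M = vertex_process.axioms(1)[OF vertex_process]

section \<open>The limits \<open>r k\<close> and \<open>\<rho>\<close>\<close>

definition H :: "real \<Rightarrow> nat \<Rightarrow> 'a \<Rightarrow> (nat \<times> nat) set" where
  "H t n \<omega> = graph_at (E n) (nat \<lfloor>t * real n\<rfloor>) \<omega>"

definition r :: "nat \<Rightarrow> real \<Rightarrow> real" where
  "r k t = (\<Sum>i<k. \<rho>k (Suc i) t)"

definition \<rho> :: "real \<Rightarrow> real" where
  "\<rho> t = 1 - (\<Sum>k. \<rho>k (Suc k) t)"

lemma H_measurable: "1 \<le> n \<Longrightarrow> (\<lambda>\<omega>. (f (H t n \<omega>) :: real)) \<in> borel_measurable (M n)"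
  unfolding H_def by (rule vertex_process.G_fun_measurable[OF vertex_process])

lemma H_mono: "0 \<le> s \<Longrightarrow> s \<le> t \<Longrightarrow> H s n \<omega> \<subseteq> H t n \<omega>"
  unfolding H_def by (intro graph_at_mono nat_floor_diff_ge(3))

lemma small_conv: "0 \<le> t \<Longrightarrow> conv_in_prob M (\<lambda>n \<omega>. small n (H t n \<omega>) k / n) (r k t)"
proof (induction k)
  case 0
  show ?case by (rule conv_in_prob_const) (simp add: r_def)
next
  case (Suc k)
  have "conv_in_prob M (\<lambda>n \<omega>. small n (H t n \<omega>) k / n + Nk n (H t n \<omega>) (Suc k) / n)
      (r k t + \<rho>k (Suc k) t)"
  proof (rule conv_in_prob_add[OF prob_space_M])
    show "conv_in_prob M (\<lambda>n \<omega>. Nk n (H t n \<omega>) (Suc k) / n) (\<rho>k (Suc k) t)"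
      unfolding H_def using Suc.prems by (intro local_conv) auto
    show "(\<lambda>\<omega>. small n (H t n \<omega>) k / n) \<in> borel_measurable (M n)"
      "(\<lambda>\<omega>. Nk n (H t n \<omega>) (Suc k) / n) \<in> borel_measurable (M n)" if "1 \<le> n" for n
      using that by (rule H_measurable)+
  qed (use Suc in auto)
  then show ?case by (simp add: small_Suc add_divide_distrib r_def)
qed

text \<open>The limits are constants, so the comparison of the random counts may fail with
  probability up to 1/2.\<close>

lemma r_le_if_small_le:
  fixes e :: real
  assumes "0 \<le> s" "0 \<le> t" "\<And>n. 1 \<le> n \<Longrightarrow> B n \<in> sets (M n)"
    and "eventually (\<lambda>n. measure (M n) (B n) \<le> 1 / 2) sequentially"
    and "eventually (\<lambda>n. \<forall>\<omega>\<in>space (M n) - B n.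
      small n (H s n \<omega>) k \<le> small n (H t n \<omega>) k' + e * n) sequentially"
  shows "r k s \<le> r k' t + e"
proof (rule conv_in_prob_le[OF prob_space_M _ _ assms(3) small_conv small_conv assms(4)])
  show "eventually (\<lambda>n. \<forall>\<omega>\<in>space (M n) - B n.
      small n (H s n \<omega>) k / n \<le> small n (H t n \<omega>) k' / n + e) sequentially"
    using assms(5) eventually_ge_at_top[of 1] by eventually_elim (simp add: field_simps)
qed (use assms in \<open>auto intro: H_measurable\<close>)

lemma r_antimono: "0 \<le> s \<Longrightarrow> s \<le> t \<Longrightarrow> r k t \<le> r k s"
  using r_le_if_small_le[of t s "\<lambda>_. {}" k k 0] small_antimono[OF H_mono] by simp

lemma r_lipschitz:
  fixes s t :: real
  assumes "0 \<le> s" "s \<le> t"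
  shows "r k s \<le> r k t + l * k * (t - s)"
proof (rule field_le_epsilon)
  fix \<delta> :: real assume \<delta>: "0 < \<delta>"
  have "r k s \<le> r k t + (l * k * (t - s) + \<delta>)"
  proof (rule r_le_if_small_le[where B = "\<lambda>_. {}"])
    \<comment> \<open>For such \<open>n\<close> the term \<open>\<delta> * n\<close> pays for the
      one additional step, of cost \<open>l * k\<close>, that rounding may cause.\<close>
    have "eventually (\<lambda>n. l * k / \<delta> \<le> real n) sequentially" by real_asymp
    then show "eventually (\<lambda>n. \<forall>\<omega>\<in>space (M n) - {}.
      small n (H s n \<omega>) k \<le> small n (H t n \<omega>) k + (l * k * (t - s) + \<delta>) * n) sequentially"
      using eventually_ge_at_top[of 1]
    proof eventually_elim
      case (elim n)
      interpret vertex_process "M n" n l "F n" "v n" "E n" using vertex_process elim by simp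
      let ?i = "nat \<lfloor>t * real n\<rfloor> - nat \<lfloor>s * real n\<rfloor>"
      show ?case
      proof
        fix \<omega> assume "\<omega> \<in> space (M n) - {}"
        then have "small n (H s n \<omega>) k \<le> small n (H t n \<omega>) k + l * k * ?i"
          using small_decrease[of \<omega> "nat \<lfloor>s * real n\<rfloor>" k ?i] nat_floor_diff_ge(3)[OF assms, of n]
          unfolding H_def by simp
        then have "real (small n (H s n \<omega>) k) \<le> real (small n (H t n \<omega>) k) + real (l * k) * real ?i"
          by (metis of_nat_add of_nat_le_iff of_nat_mult)
        also have "real (l * k) * real ?i \<le> real (l * k) * ((t - s) * n + 1)"
          using nat_floor_diff_ge(2)[OF assms, of n] by (intro mult_left_mono) auto
        also have "\<dots> \<le> (l * k * (t - s) + \<delta>) * n"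
          using elim \<delta> by (simp add: field_simps)
        finally show "real (small n (H s n \<omega>) k) \<le> small n (H t n \<omega>) k + (l * k * (t - s) + \<delta>) * n"
          by simp
      qed
    qed
  qed (use assms in auto)
  then show "r k s \<le> r k t + l * k * (t - s) + \<delta>" by simp
qed

lemma r_le_1: assumes "0 \<le> t" shows "r k t \<le> 1"
proof -
  have "r k t \<le> r 0 t + 1"
    using assms small_le by (intro r_le_if_small_le[where B = "\<lambda>_. {}"]) auto
  then show ?thesis by (simp add: r_def)
qed

lemma r_mono: "0 \<le> t \<Longrightarrow> k \<le> K \<Longrightarrow> r k t \<le> r K t"
  unfolding r_def using \<rho>k_bounds by (intro sum_mono2) auto

lemma r_nonneg: "0 \<le> t \<Longrightarrow> 0 \<le> r k t"
  using r_mono[of t 0 k] by (simp add: r_def)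

text \<open>The partial sums are increasing and bounded by 1, so the series in \<open>\<rho>\<close>
  converges and its value is the true limit.\<close>

lemma r_tendsto: assumes "0 \<le> t" shows "(\<lambda>k. r k t) \<longlonglongrightarrow> 1 - \<rho> t"
proof -
  have "summable (\<lambda>k. \<rho>k (Suc k) t)"
    using r_le_1[OF assms] \<rho>k_bounds[OF assms]
    by (intro summableI_nonneg_bounded[where x = 1]) (auto simp: r_def)
  then show ?thesis unfolding r_def \<rho>_def by (simp add: summable_LIMSEQ)
qed

lemma r_le_rho: assumes "0 \<le> t" shows "r k t \<le> 1 - \<rho> t"
  by (rule incseq_le[OF _ r_tendsto[OF assms]]) (auto simp: incseq_def r_mono[OF assms])

lemma rho_geI: "0 \<le> t \<Longrightarrow> (\<And>k. r k t \<le> 1 - c) \<Longrightarrow> c \<le> \<rho> t"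
  using LIMSEQ_le_const2[OF r_tendsto, of t "1 - c"] by auto

lemma rho_mono: "0 \<le> s \<Longrightarrow> s \<le> t \<Longrightarrow> \<rho> s \<le> \<rho> t"
  using order_trans[OF r_antimono[of s t] r_le_rho[of s]] by (intro rho_geI) auto

lemma rho_bounds: assumes "0 \<le> t" shows "\<rho> t \<in> {0..1}"
  using rho_geI[of t 0] r_le_1[of t] r_le_rho[of t 0] r_nonneg[of t 0] assms by simp

text \<open>At time 0 all components are single vertices, so \<open>r 1 0\<close> is already 1. The
  value is needed in \<open>L1_lower\<close>, where time 0 has no earlier time to start
  from.\<close>

lemma rho_0: "\<rho> 0 = 0"
proof -
  have comp0: "comp n {} x = {x}" if "x < n" for n x
    using that by (auto simp: comp_def conn_def)
  have "Nk n (H 0 n \<omega>) 1 = n" for n \<omega>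
  proof -
    have "{x. x < n \<and> card (comp n {} x) = 1} = {..<n}" by (auto simp: comp0)
    then show ?thesis by (simp add: Nk_def H_def)
  qed
  then have "small n (H 0 n \<omega>) 1 = n" for n \<omega> using small_Suc[of n "H 0 n \<omega>" 0] by simp
  then have "conv_in_prob M (\<lambda>n \<omega>. small n (H 0 n \<omega>) 1 / n) 1"
    by (intro conv_in_prob_const) simp
  then have "1 \<le> r 1 0 + 0"
    by (intro conv_in_prob_le[OF prob_space_M _ _ _ _ small_conv, where B = "\<lambda>_. {}"])
      (auto intro: H_measurable)
  then show ?thesis using r_le_rho[of 0 1] rho_bounds[of 0] by simp
qed

section \<open>Growth of components from constant to linear size\<close>

definition stuck :: "real \<Rightarrow> nat \<Rightarrow> real \<Rightarrow> real \<Rightarrow> nat \<Rightarrow> 'a set" where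
  "stuck \<epsilon> K s u n = {\<omega>\<in>space (M n). \<epsilon> * real n \<le> real (card {x. x < n \<and>
     K < card (comp n (H s n \<omega>) x) \<and> card (comp n (H u n \<omega>) x) < \<epsilon> / (2 * l) * n})}"

lemma stuck_event: "1 \<le> n \<Longrightarrow> stuck \<epsilon> K s u n \<in> sets (M n)"
  unfolding stuck_def H_def by (rule vertex_process.G_event2[OF vertex_process])

text \<open>Both the number of steps and the number of components above size \<open>K\<close> are of
  order \<open>n\<close>, so \<open>n\<close> cancels and a large \<open>K\<close> makes the bound
  small. The factor 2 comes from estimating the number of steps by
  \<open>(u - s) / 2 * n\<close>.\<close>

lemma eventually_stuck_le:
  assumes "0 < \<epsilon>" "1 \<le> K" "0 \<le> s" "s < u"
  shows "eventually (\<lambda>n. measure (M n) (stuck \<epsilon> K s u n) \<le> 2 / (K * (\<epsilon> / 2) ^ l * (u - s)))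
    sequentially"
  using eventually_nat_floor_diff_ge[OF assms(3,4)] eventually_ge_at_top[of 1]
proof eventually_elim
  case (elim n)
  interpret vertex_process "M n" n l "F n" "v n" "E n" using vertex_process elim by simp
  let ?i = "nat \<lfloor>u * real n\<rfloor> - nat \<lfloor>s * real n\<rfloor>" and ?p = "(\<epsilon> / 2) ^ l"
  have p: "0 < ?p" using assms by simp
  have "(u - s) / 2 * n * (?p * prob (stuck \<epsilon> K s u n)) \<le> real ?i * (?p * prob (stuck \<epsilon> K s u n))"
    using elim p by (intro mult_right_mono) auto
  also have "\<dots> \<le> n / K"
    using few_vertices_in_intermediate_components[OF assms(1,2) _ nat_floor_diff_ge(3)[of s u n]]
      assms l_ge by (simp add: stuck_def H_def mult.assoc)
  finally have "real n * ((u - s) / 2 * (?p * prob (stuck \<epsilon> K s u n))) \<le> real n * (1 / K)"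
    by (simp add: mult_ac)
  then have "(u - s) / 2 * (?p * prob (stuck \<epsilon> K s u n)) \<le> 1 / K"
    using elim by (simp only: mult_le_cancel_left_pos of_nat_0_less_iff)
  then have "prob (stuck \<epsilon> K s u n) * (K * ?p * (u - s)) \<le> 2"
    using assms by (simp only: pos_le_divide_eq of_nat_0_less_iff) (simp add: mult_ac)
  then show ?case using p assms by (subst pos_le_divide_eq) simp_all
qed

text \<open>A vertex in a component of size at most \<open>K'\<close> at time \<open>u\<close>
  either was in one of size at most \<open>K\<close> at time \<open>s\<close>, or belongs to the
  exceptional set in \<open>stuck\<close>.\<close>

lemma not_stuck_small_le:
  fixes \<epsilon> :: real
  assumes "\<omega> \<in> space (M n) - stuck \<epsilon> K s u n" "K' < \<epsilon> / (2 * l) * n"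
  shows "small n (H u n \<omega>) K' \<le> small n (H s n \<omega>) K + \<epsilon> * n"
proof -
  let ?S = "{x. x < n \<and> K < card (comp n (H s n \<omega>) x) \<and> card (comp n (H u n \<omega>) x) < \<epsilon> / (2 * l) * n}"
  have "{x. x < n \<and> card (comp n (H u n \<omega>) x) \<le> K'} \<subseteq> {x. x < n \<and> card (comp n (H s n \<omega>) x) \<le> K} \<union> ?S"
    using assms(2) by auto
  then have "small n (H u n \<omega>) K' \<le> small n (H s n \<omega>) K + card ?S"
    unfolding small_def by (intro order_trans[OF card_mono card_Un_le]) auto
  moreover have "card ?S < \<epsilon> * n" using assms(1) by (auto simp: stuck_def)
  ultimately show ?thesis by linarith
qed

text \<open>Vertices beyond size \<open>K\<close> at time \<open>s\<close> reach linear size, up to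
  a proportion \<open>\<epsilon>\<close>, within a time of order \<open>1 / K\<close>; from then on
  they are counted by no \<open>r K'\<close>, hence by \<open>\<rho>\<close>.\<close>

lemma rho_growth:
  assumes "0 < \<epsilon>" "1 \<le> K" "0 \<le> s"
  shows "1 - r K s - \<epsilon> \<le> \<rho> (s + 4 / (\<epsilon> / 2) ^ l / K)"
proof (rule rho_geI)
  let ?u = "s + 4 / (\<epsilon> / 2) ^ l / K"
  have su: "s < ?u" using assms by simp
  show u: "0 \<le> ?u" using assms by simp
  fix K'
  have "r K' ?u \<le> r K s + \<epsilon>"
  proof (rule r_le_if_small_le[OF u assms(3) stuck_event])
    \<comment> \<open>The waiting time is chosen to make the bound of
      \<open>eventually_stuck_le\<close> equal to 1/2, the largest value that
      \<open>r_le_if_small_le\<close> admits.\<close>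
    have "2 / (K * (\<epsilon> / 2) ^ l * (?u - s)) = 1 / 2"
      using assms by (simp add: field_simps)
    then show "eventually (\<lambda>n. measure (M n) (stuck \<epsilon> K s ?u n) \<le> 1 / 2) sequentially"
      using eventually_stuck_le[OF assms su] by simp
    have "0 < \<epsilon> / (2 * l)" using assms l_ge by simp
    then have "eventually (\<lambda>n. K' < \<epsilon> / (2 * l) * real n) sequentially" by real_asymp
    then show "eventually (\<lambda>n. \<forall>\<omega>\<in>space (M n) - stuck \<epsilon> K s ?u n.
        small n (H ?u n \<omega>) K' \<le> small n (H s n \<omega>) K + \<epsilon> * n) sequentially"
      by eventually_elim (use not_stuck_small_le in blast)
  qed
  then show "r K' ?u \<le> 1 - (1 - r K s - \<epsilon>)" by simp
qed

section \<open>Continuity of \<open>\<rho>\<close>\<close>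

lemma expectation_small:
  "0 \<le> t \<Longrightarrow> (\<lambda>n. integral\<^sup>L (M n) (\<lambda>\<omega>. small n (H t n \<omega>) k / n)) \<longlonglongrightarrow> r k t"
  by (rule conv_in_prob_expectation[OF prob_space_M H_measurable _ _ small_conv])
    (use small_le r_nonneg r_le_1 in \<open>auto simp: divide_le_eq\<close>)

text \<open>This is the limit of \<open>expectation_card_size_in_decay\<close> for the sizes in
  \<open>{k<..K}\<close>. The 4 in the exponent is a product of two factors 2: one from
  \<open>exp_le_one_minus\<close>, the other from bounding the number of steps by
  \<open>2 * ((t - s) * n)\<close>.\<close>

lemma r_band_decay:
  fixes s t :: real
  assumes "0 \<le> s" "s < t" "k \<le> K"
  shows "exp (- (4 * l * K * (t - s))) * (r K s - r k s) \<le> r K t - r k t"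
proof -
  let ?e = "\<lambda>t k n. integral\<^sup>L (M n) (\<lambda>\<omega>. small n (H t n \<omega>) k / n)"
  have "(\<lambda>n. ?e t K n - ?e t k n) \<longlonglongrightarrow> r K t - r k t"
    "(\<lambda>n. exp (- (4 * l * K * (t - s))) * (?e s K n - ?e s k n)) \<longlonglongrightarrow>
      exp (- (4 * l * K * (t - s))) * (r K s - r k s)"
    using assms by (intro tendsto_intros expectation_small; simp)+
  moreover have "eventually (\<lambda>n. exp (- (4 * l * K * (t - s))) * (?e s K n - ?e s k n)
      \<le> ?e t K n - ?e t k n) sequentially"
  proof -
    have "eventually (\<lambda>n. 2 * l * K \<le> real n) sequentially"
      "eventually (\<lambda>n. 1 / (t - s) \<le> real n) sequentially" by real_asymp+
    then show ?thesis using eventually_ge_at_top[of 1]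
    proof eventually_elim
      case (elim n)
      interpret vertex_process "M n" n l "F n" "v n" "E n" using vertex_process elim by simp
      let ?i = "nat \<lfloor>t * real n\<rfloor> - nat \<lfloor>s * real n\<rfloor>" and ?x = "l * K / n"
      let ?c = "\<lambda>t. expectation (\<lambda>\<omega>. card {x. x < n \<and> card (comp n (H t n \<omega>) x) \<in> {k<..K}})"
      have c: "?e t K n - ?e t k n = ?c t / n" for t
      proof -
        have "?c t = expectation (\<lambda>\<omega>. real (small n (H t n \<omega>) K)) - expectation (\<lambda>\<omega>. small n (H t n \<omega>) k)"
          unfolding card_size_between[OF assms(3)] H_def
          by (rule Bochner_Integration.integral_diff[OF integrable_G_fun integrable_G_fun])
        then show ?thesis by (simp add: diff_divide_distrib)
      qed
      have x: "0 \<le> ?x" "?x \<le> 1 / 2" using elim by (auto simp: field_simps)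
      have "real ?i \<le> (t - s) * n + 1" using nat_floor_diff_ge(2) assms by simp
      also have "\<dots> \<le> 2 * ((t - s) * n)" using elim assms by (simp add: field_simps)
      finally have "?x * real ?i \<le> ?x * (2 * ((t - s) * n))" using x(1) by (rule mult_left_mono)
      also have "\<dots> = 2 * l * K * (t - s)" using elim by (simp add: field_simps)
      finally have "exp (- (4 * l * K * (t - s))) \<le> exp (real ?i * (- (2 * ?x)))"
        by (simp add: mult.commute)
      also have "\<dots> = exp (- (2 * ?x)) ^ ?i" by (rule exp_of_nat_mult)
      also have "\<dots> \<le> (1 - ?x) ^ ?i" using exp_le_one_minus[OF x] by (intro power_mono) auto
      finally have "exp (- (4 * l * K * (t - s))) * ?c s \<le> (1 - ?x) ^ ?i * ?c s"
        by (rule mult_right_mono) simp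
      also have "\<dots> \<le> ?c t"
      proof -
        have "l * K \<le> n" using x(2) elim by (simp add: field_simps flip: of_nat_mult)
        moreover have "{k<..K} \<subseteq> {..K}" by auto
        ultimately show ?thesis
          using expectation_card_size_in_decay[of "{k<..K}" K ?i "nat \<lfloor>s * real n\<rfloor>"]
            nat_floor_diff_ge(3)[of s t n] assms by (simp add: H_def)
      qed
      finally show ?case unfolding c using elim by (simp add: divide_right_mono)
    qed
  qed
  ultimately show ?thesis by (rule tendsto_le[OF sequentially_bot])
qed

text \<open>If \<open>\<rho>\<close> jumped at \<open>t\<close>, then at time \<open>t - c / k\<close> a constant proportion of the vertices would lie in
  components of sizes between \<open>k\<close> and \<open>B k\<close>: not in smaller ones by the Lipschitz bound, not in larger
  ones because by \<open>rho_growth\<close> those would give \<open>\<rho>\<close> its new value before time \<open>t\<close>. A component of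
  size at most \<open>B k\<close> stays untouched for \<open>c n / k\<close> steps with probability bounded below, so
  at time \<open>t\<close> a proportion of the vertices bounded away from \<open>0\<close> independently of \<open>k\<close> is in
  components of such sizes, which contradicts the convergence of \<open>r k t\<close> as \<open>k \<rightarrow> \<infinity>\<close>.\<close>

lemma rho_no_jump_left:
  fixes t a :: real
  assumes "0 < t" "a < \<rho> t"
  shows "\<exists>s. 0 \<le> s \<and> s < t \<and> a < \<rho> s"
proof (rule ccontr)
  assume "\<not> ?thesis"
  then have before: "\<rho> s \<le> a" if "0 \<le> s" "s < t" for s using that by fastforce
  define d where "d = \<rho> t - a"
  \<comment> \<open>Two errors of size \<open>\<epsilon>\<close> occur below, from
    \<open>rho_growth\<close> and from the Lipschitz bound; a quarter of \<open>d\<close> for each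
    leaves \<open>d / 2\<close> for the band.\<close>
  define \<epsilon> where "\<epsilon> = d / 4"
  define C where "C = 4 / (\<epsilon> / 2) ^ l"
  \<comment> \<open>With this \<open>c\<close>, the Lipschitz bound for \<open>r k\<close> over a
    time \<open>c / k\<close> costs exactly \<open>\<epsilon>\<close>.\<close>
  define c where "c = \<epsilon> / l"
  have d: "0 < d" and \<epsilon>: "0 < \<epsilon>" using assms by (auto simp: d_def \<epsilon>_def)
  then have C: "0 < C" and c: "0 < c" using l_ge by (auto simp: C_def c_def)
  \<comment> \<open>\<open>B\<close> is so large that the waiting time \<open>C / (k * B)\<close> in
    \<open>rho_growth\<close> is shorter than \<open>c / k\<close>, hence over before
    \<open>t\<close>.\<close>
  obtain B :: nat where "2 * C / c < B" using reals_Archimedean2 by blast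
  then have B: "2 * C < c * B" using c by (simp add: field_simps)
  then have B1: "1 \<le> B" using C by (cases B) auto
  \<comment> \<open>For sizes up to \<open>k * B\<close> over a time \<open>c / k\<close>, the
    factor \<open>k\<close> cancels in the exponent of \<open>r_band_decay\<close>, so
    \<open>\<eta>\<close> does not depend on \<open>k\<close>.\<close>
  define \<eta> where "\<eta> = exp (- (4 * l * B * c)) * (d / 2)"
  have \<eta>: "0 < \<eta>" using d by (simp add: \<eta>_def)
  have band: "\<eta> \<le> r (k * B) t - r k t" if k: "1 \<le> k" "c / t \<le> k" for k
  proof -
    define s where "s = t - c / k"
    define u where "u = s + C / (k * B)"
    have s: "0 \<le> s" "s < t" using k c assms(1) by (auto simp: s_def field_simps)
    have "C / (k * B) < c / k" using B B1 k C by (simp add: field_simps)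
    then have u: "0 \<le> u" "u < t" using s C k B1 by (auto simp: u_def s_def)
    have "1 - r (k * B) s - \<epsilon> \<le> \<rho> u"
      using rho_growth[OF \<epsilon> _ s(1), of "k * B"] k B1 by (simp add: u_def C_def)
    also have "\<dots> \<le> a" using u by (rule before)
    finally have 1: "1 - \<epsilon> - a \<le> r (k * B) s" by simp
    have "l * k * (t - s) = \<epsilon>" using k l_ge by (simp add: s_def c_def)
    then have "r k s \<le> r k t + \<epsilon>" using r_lipschitz[of s t k] s by simp
    also have "r k t \<le> 1 - \<rho> t" using assms by (intro r_le_rho) simp
    finally have "d / 2 \<le> r (k * B) s - r k s" using 1 by (simp add: d_def \<epsilon>_def field_simps)
    then have "\<eta> \<le> exp (- (4 * l * B * c)) * (r (k * B) s - r k s)"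
      unfolding \<eta>_def by (intro mult_left_mono) auto
    also have "4 * l * B * c = 4 * l * real (k * B) * (t - s)" using k by (simp add: s_def)
    also have "exp (- \<dots>) * (r (k * B) s - r k s) \<le> r (k * B) t - r k t"
      using r_band_decay[OF s, of k "k * B"] B1 by simp
    finally show ?thesis .
  qed
  have "(\<lambda>k. r (k * B) t - r k t) \<longlonglongrightarrow> (1 - \<rho> t) - (1 - \<rho> t)"
  proof (intro tendsto_diff)
    have lim: "(\<lambda>k. r k t) \<longlonglongrightarrow> 1 - \<rho> t" using assms by (intro r_tendsto) simp
    then show "(\<lambda>k. r k t) \<longlonglongrightarrow> 1 - \<rho> t" .
    have "strict_mono (\<lambda>k. k * B)" using B1 by (auto simp: strict_mono_def)
    from LIMSEQ_subseq_LIMSEQ[OF lim this] show "(\<lambda>k. r (k * B) t) \<longlonglongrightarrow> 1 - \<rho> t"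
      by (simp add: o_def)
  qed
  then have "eventually (\<lambda>k. r (k * B) t - r k t < \<eta>) sequentially"
    using \<eta> by (intro order_tendstoD(2)) auto
  moreover have "eventually (\<lambda>k. c / t \<le> real k) sequentially" by real_asymp
  ultimately have "eventually (\<lambda>k. False) sequentially"
    using eventually_ge_at_top[of 1] by eventually_elim (use band in \<open>meson not_less\<close>)
  then show False by simp
qed

lemma exists_r_gt:
  assumes "0 \<le> t" "0 < e" obtains k where "1 - \<rho> t - e < r k t"
proof -
  have "eventually (\<lambda>k. 1 - \<rho> t - e < r k t) sequentially"
    using assms by (intro order_tendstoD(1)[OF r_tendsto]) auto
  then show ?thesis using that by (auto simp: eventually_sequentially)
qed

text \<open>On the right, one \<open>r k\<close> close to its limit at \<open>t\<close> suffices, as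
  it is Lipschitz and \<open>1 - r k\<close> bounds \<open>\<rho>\<close> from above. On the left,
  monotonicity extends the single earlier time from \<open>rho_no_jump_left\<close> to an
  interval.\<close>

lemma rho_continuous: "continuous_on {0..} \<rho>"
  unfolding continuous_on_iff
proof (intro ballI allI impI)
  fix t e :: real assume "t \<in> {0..}" and e: "0 < e"
  then have t: "0 \<le> t" by simp
  obtain k where k: "1 - \<rho> t - e / 2 < r k t" using exists_r_gt[OF t, of "e / 2"] e by auto
  \<comment> \<open>The summand 1 keeps the denominator positive when \<open>k = 0\<close>.\<close>
  define \<delta>1 where "\<delta>1 = e / (2 * (l * k + 1))"
  have \<delta>1: "0 < \<delta>1" using e by (simp add: \<delta>1_def del: of_nat_mult of_nat_add of_nat_Suc)
  have right: "\<rho> s < \<rho> t + e" if "t \<le> s" "s < t + \<delta>1" for s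
  proof -
    have "\<rho> s \<le> 1 - r k s" using r_le_rho[of s k] that t by simp
    moreover have "r k t \<le> r k s + l * k * (s - t)" using r_lipschitz[of t s k] that t by simp
    moreover have "l * k * (s - t) \<le> (l * k + 1) * \<delta>1" using that by (intro mult_mono) auto
    moreover have "(l * k + 1) * \<delta>1 = e / 2"
      unfolding \<delta>1_def by (simp add: field_simps add_nonneg_eq_0_iff)
    ultimately show ?thesis using k by linarith
  qed
  have "\<exists>\<delta>2>0. \<forall>s\<ge>0. t - \<delta>2 < s \<longrightarrow> s \<le> t \<longrightarrow> \<rho> t - e < \<rho> s"
  proof (cases "t = 0")
    case True
    then show ?thesis using e by (intro exI[of _ 1]) auto
  next
    case False
    then obtain s0 where s0: "0 \<le> s0" "s0 < t" "\<rho> t - e < \<rho> s0"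
      using rho_no_jump_left[of t "\<rho> t - e"] t e by auto
    then show ?thesis
      by (intro exI[of _ "t - s0"]) (auto intro: less_le_trans[OF _ rho_mono])
  qed
  then obtain \<delta>2 where \<delta>2: "0 < \<delta>2" "\<And>s. 0 \<le> s \<Longrightarrow> t - \<delta>2 < s \<Longrightarrow> s \<le> t \<Longrightarrow> \<rho> t - e < \<rho> s"
    by blast
  show "\<exists>d>0. \<forall>s\<in>{0..}. dist s t < d \<longrightarrow> dist (\<rho> s) (\<rho> t) < e"
  proof (intro exI[of _ "min \<delta>1 \<delta>2"] conjI ballI impI)
    fix s assume "s \<in> {0..}" "dist s t < min \<delta>1 \<delta>2"
    then have s: "0 \<le> s" "\<bar>s - t\<bar> < \<delta>1" "\<bar>s - t\<bar> < \<delta>2" by (auto simp: dist_real_def)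
    show "dist (\<rho> s) (\<rho> t) < e"
    proof (cases "t \<le> s")
      case True
      then have "\<rho> s < \<rho> t + e" "\<rho> t \<le> \<rho> s" using right s rho_mono t by auto
      then show ?thesis by (simp add: dist_real_def)
    next
      case False
      then have "\<rho> t - e < \<rho> s" "\<rho> s \<le> \<rho> t" using \<delta>2(2)[of s] s rho_mono[of s t] by auto
      then show ?thesis by (simp add: dist_real_def)
    qed
  qed (use \<delta>1 \<delta>2 in auto)
qed

section \<open>The largest component\<close>

lemma H_event: "1 \<le> n \<Longrightarrow> {\<omega>\<in>space (M n). Q (H t n \<omega>)} \<in> sets (M n)"
  unfolding H_def by (rule vertex_process.G_event[OF vertex_process])

text \<open>For one fixed large \<open>k\<close>, a component with more than \<open>k\<close>
  vertices lies outside those counted by \<open>small\<close>, whose proportion is close to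
  \<open>r k t\<close> and thus nearly \<open>1 - \<rho> t\<close>.\<close>

lemma L1_upper:
  fixes \<delta> \<eta> :: real
  assumes "0 \<le> t" "0 < \<delta>" "0 < \<eta>"
  shows "eventually (\<lambda>n. measure (M n) {\<omega>\<in>space (M n). \<rho> t + \<delta> < L1 n (H t n \<omega>) / n} < \<eta>) sequentially"
proof -
  obtain k where k: "1 - \<rho> t - \<delta> / 2 < r k t" using exists_r_gt[of t "\<delta> / 2"] assms by auto
  have "eventually (\<lambda>n. k / \<delta> \<le> real n) sequentially" by real_asymp
  moreover have "eventually (\<lambda>n. measure (M n) {\<omega>\<in>space (M n).
      \<bar>small n (H t n \<omega>) k / n - r k t\<bar> > \<delta> / 2} < \<eta>) sequentially"
    using assms by (intro conv_in_prob_eventually small_conv) auto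
  ultimately show ?thesis using eventually_ge_at_top[of 1]
  proof eventually_elim
    case (elim n)
    interpret prob_space "M n" using prob_space_M elim by simp
    have "prob {\<omega>\<in>space (M n). \<rho> t + \<delta> < L1 n (H t n \<omega>) / n} \<le>
        prob {\<omega>\<in>space (M n). \<bar>small n (H t n \<omega>) k / n - r k t\<bar> > \<delta> / 2}"
    proof (rule finite_measure_mono)
      show "{\<omega>\<in>space (M n). \<bar>small n (H t n \<omega>) k / n - r k t\<bar> > \<delta> / 2} \<in> events"
        using elim by (intro H_event) simp
      show "{\<omega>\<in>space (M n). \<rho> t + \<delta> < L1 n (H t n \<omega>) / n} \<subseteq>
        {\<omega>\<in>space (M n). \<bar>small n (H t n \<omega>) k / n - r k t\<bar> > \<delta> / 2}"
      proof safe
        fix \<omega> assume L: "\<rho> t + \<delta> < L1 n (H t n \<omega>) / n"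
        \<comment> \<open>For these \<open>n\<close>, a largest component of at most
          \<open>k\<close> vertices would have proportion at most \<open>\<delta>\<close>, so the
          first alternative of \<open>L1_le\<close> is excluded.\<close>
        have "k / n \<le> \<delta>" using elim assms by (simp add: field_simps)
        then have "real k / n < L1 n (H t n \<omega>) / n" using L rho_bounds[OF assms(1)] by auto
        then have "k < L1 n (H t n \<omega>)" using elim by (simp add: divide_less_cancel)
        then have "L1 n (H t n \<omega>) \<le> n - small n (H t n \<omega>) k"
          using L1_le[of n "H t n \<omega>" k] elim by auto
        then have "real (L1 n (H t n \<omega>)) \<le> real n - small n (H t n \<omega>) k"
          using small_le[of n "H t n \<omega>" k] by linarith
        then have "L1 n (H t n \<omega>) / n \<le> (real n - small n (H t n \<omega>) k) / n"
          by (rule divide_right_mono) simp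
        also have "\<dots> = 1 - small n (H t n \<omega>) k / n" using elim by (simp add: field_simps)
        finally show "\<bar>small n (H t n \<omega>) k / n - r k t\<bar> > \<delta> / 2" using L k by linarith
      qed
    qed
    then show ?case using elim by linarith
  qed
qed

definition unmerged :: "real \<Rightarrow> real \<Rightarrow> real \<Rightarrow> nat \<Rightarrow> 'a set" where
  "unmerged \<beta> u t n = {\<omega>\<in>space (M n). \<exists>x<n. \<exists>y<n.
      \<beta> * n \<le> card (comp n (H u n \<omega>) x) \<and> \<beta> * n \<le> card (comp n (H u n \<omega>) y) \<and>
      \<not> conn n (H t n \<omega>) x y}"

lemma unmerged_event: "1 \<le> n \<Longrightarrow> unmerged \<beta> u t n \<in> sets (M n)"
  unfolding unmerged_def H_def by (rule vertex_process.G_event2[OF vertex_process])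

lemma eventually_unmerged_less:
  assumes "0 < \<beta>" "0 \<le> u" "u < t" "0 < \<eta>"
  shows "eventually (\<lambda>n. measure (M n) (unmerged \<beta> u t n) < \<eta>) sequentially"
proof -
  \<comment> \<open>Solved from the bound of \<open>large_components_merge\<close> with at least
    \<open>(t - u) / 2 * n\<close> steps: beyond \<open>X\<close> the probability is below
    \<open>\<eta>\<close>.\<close>
  define X where "X = 2 / (\<beta> * \<beta> ^ l * (t - u) * \<eta>)"
  have "eventually (\<lambda>n. X < real n) sequentially" by real_asymp
  with eventually_nat_floor_diff_ge[OF assms(2,3)] show ?thesis using eventually_ge_at_top[of 1]
  proof eventually_elim
    case (elim n)
    interpret merging_process "M n" n l "F n" "v n" "E n" using merging_process elim by simp
    let ?i = "nat \<lfloor>t * real n\<rfloor> - nat \<lfloor>u * real n\<rfloor>" and ?P = "prob (unmerged \<beta> u t n)"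
    have p: "0 < \<beta> ^ l" using assms by simp
    have "(t - u) / 2 * n * (\<beta> ^ l * ?P) \<le> real ?i * (\<beta> ^ l * ?P)"
      using elim p by (intro mult_right_mono) auto
    also have "\<dots> \<le> 1 / \<beta>"
      using large_components_merge[OF assms(1) nat_floor_diff_ge(3)[of u t n]] assms
      by (simp add: unmerged_def H_def mult.assoc)
    finally have 1: "(\<beta> * \<beta> ^ l * (t - u)) * n * ?P \<le> 2" using assms by (simp add: field_simps)
    have "2 < (\<beta> * \<beta> ^ l * (t - u)) * n * \<eta>"
      using elim assms unfolding X_def by (subst (asm) pos_divide_less_eq) (simp_all add: mult_ac)
    with 1 have "(\<beta> * \<beta> ^ l * (t - u)) * n * ?P < (\<beta> * \<beta> ^ l * (t - u)) * n * \<eta>" by linarith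
    moreover have "0 < (\<beta> * \<beta> ^ l * (t - u)) * n" using assms elim by simp
    ultimately show ?case by (simp only: mult_less_cancel_left_pos)
  qed
qed

text \<open>The threshold \<open>\<epsilon> / (2 * l)\<close> is the same for \<open>stuck\<close>
  and \<open>unmerged\<close>: all but \<open>\<epsilon> * n\<close> of the vertices beyond size
  \<open>K\<close> at time \<open>s\<close> are above it at time \<open>u\<close>, and by time
  \<open>t\<close> these lie in a single component.\<close>

lemma not_unmerged_L1_ge:
  assumes "\<omega> \<in> space (M n)" "\<omega> \<notin> stuck \<epsilon> K s u n" "\<omega> \<notin> unmerged (\<epsilon> / (2 * l)) u t n"
  shows "real n - small n (H s n \<omega>) K - \<epsilon> * n \<le> L1 n (H t n \<omega>)"
proof -
  define U where "U = {x. x < n \<and> \<epsilon> / (2 * l) * n \<le> card (comp n (H u n \<omega>) x)}"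
  let ?S = "{x. x < n \<and> K < card (comp n (H s n \<omega>) x) \<and> card (comp n (H u n \<omega>) x) < \<epsilon> / (2 * l) * n}"
  have "{x. x < n \<and> K < card (comp n (H s n \<omega>) x)} \<subseteq> U \<union> ?S" by (auto simp: U_def)
  then have "card {x. x < n \<and> K < card (comp n (H s n \<omega>) x)} \<le> card U + card ?S"
    by (intro order_trans[OF card_mono card_Un_le]) (auto simp: U_def)
  then have 1: "n - small n (H s n \<omega>) K \<le> card U + card ?S" by (simp add: card_size_gt)
  have 2: "card ?S < \<epsilon> * n" using assms(1,2) by (auto simp: stuck_def)
  have "card U \<le> L1 n (H t n \<omega>)"
  proof (cases "U = {}")
    case False
    then obtain x where x: "x \<in> U" by blast
    have "U \<subseteq> comp n (H t n \<omega>) x"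
      using x assms(1,3) by (auto simp: U_def unmerged_def comp_def)
    then have "card U \<le> card (comp n (H t n \<omega>) x)" by (intro card_mono) auto
    also have "\<dots> \<le> L1 n (H t n \<omega>)" using x by (intro card_comp_le_L1) (simp add: U_def)
    finally show ?thesis .
  qed simp
  with 1 2 show ?thesis using small_le[of n "H s n \<omega>" K] by linarith
qed

text \<open>Since \<open>\<rho>\<close> has no jump at \<open>t\<close>, the argument may start at
  some \<open>s < t\<close> with \<open>\<rho> s\<close> close to \<open>\<rho> t\<close>.
  Components reach linear size between \<open>s\<close> and the midpoint \<open>u\<close>, and merge
  between \<open>u\<close> and \<open>t\<close>.\<close>

lemma L1_lower:
  fixes \<delta> \<eta> :: real
  assumes "0 \<le> t" "0 < \<delta>" "0 < \<eta>"
  shows "eventually (\<lambda>n. measure (M n) {\<omega>\<in>space (M n). L1 n (H t n \<omega>) / n < \<rho> t - \<delta>} < \<eta>) sequentially"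
proof (cases "t = 0")
  case True
  have "\<not> real (L1 n (H t n \<omega>)) / n < \<rho> t - \<delta>" for n \<omega>
    using assms rho_0 True by (simp add: not_less order_trans[of _ 0])
  then show ?thesis using assms by simp
next
  case False
  \<comment> \<open>Three errors of \<open>\<epsilon>\<close> add up: the change of
    \<open>\<rho>\<close> from \<open>s\<close> to \<open>t\<close>, the deviation of
    \<open>small\<close> from its limit, and the vertices allowed by \<open>stuck\<close>.\<close>
  define \<epsilon> where "\<epsilon> = \<delta> / 4"
  have \<epsilon>: "0 < \<epsilon>" "0 < \<epsilon> / (2 * l)" using assms l_ge by (auto simp: \<epsilon>_def)
  obtain s where s: "0 \<le> s" "s < t" "\<rho> t - \<epsilon> < \<rho> s"
    using rho_no_jump_left[of t "\<rho> t - \<epsilon>"] assms \<epsilon> False by auto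
  define u where "u = (s + t) / 2"
  have u: "0 \<le> u" "s < u" "u < t" using s by (auto simp: u_def)
  define D where "D = (\<epsilon> / 2) ^ l * (u - s)"
  have D: "0 < D" using \<epsilon> u by (simp add: D_def)
  \<comment> \<open>This makes the bound \<open>2 / (K * D)\<close> for \<open>stuck\<close> at most
    \<open>\<eta> / 4\<close>, so that the three exceptional events together stay below
    \<open>\<eta>\<close>.\<close>
  obtain K :: nat where "8 / (\<eta> * D) < K" using reals_Archimedean2 by blast
  then have K0: "8 < K * (\<eta> * D)" using assms D by (simp add: field_simps)
  then have K: "1 \<le> K" by (cases K) auto
  have "2 / (K * (\<epsilon> / 2) ^ l * (u - s)) = 2 / (K * D)" by (simp add: D_def mult.assoc)
  also have "\<dots> \<le> \<eta> / 4" using K0 K D assms by (simp add: field_simps)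
  finally have KD: "2 / (K * (\<epsilon> / 2) ^ l * (u - s)) \<le> \<eta> / 4" .
  let ?A = "\<lambda>n. {\<omega>\<in>space (M n). \<bar>small n (H s n \<omega>) K / n - r K s\<bar> > \<epsilon>}"
  have "eventually (\<lambda>n. measure (M n) (?A n) < \<eta> / 4) sequentially"
    using assms \<epsilon> s by (intro conv_in_prob_eventually small_conv) auto
  moreover have "eventually (\<lambda>n. measure (M n) (unmerged (\<epsilon> / (2 * l)) u t n) < \<eta> / 4) sequentially"
    using assms \<epsilon> u by (intro eventually_unmerged_less) auto
  ultimately show ?thesis
    using eventually_stuck_le[OF \<epsilon>(1) K s(1) u(2)] eventually_ge_at_top[of 1]
  proof eventually_elim
    case (elim n)
    interpret prob_space "M n" using prob_space_M elim by simp
    let ?S = "stuck \<epsilon> K s u n" and ?U = "unmerged (\<epsilon> / (2 * l)) u t n"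
    have ev: "?A n \<in> events" "?S \<in> events" "?U \<in> events"
      using elim by (intro H_event stuck_event unmerged_event; simp)+
    have "prob {\<omega>\<in>space (M n). L1 n (H t n \<omega>) / n < \<rho> t - \<delta>} \<le> prob (?A n \<union> ?S \<union> ?U)"
    proof (rule finite_measure_mono)
      show "{\<omega>\<in>space (M n). L1 n (H t n \<omega>) / n < \<rho> t - \<delta>} \<subseteq> ?A n \<union> ?S \<union> ?U"
      proof (rule subsetI, rule ccontr)
        fix \<omega> assume \<omega>: "\<omega> \<in> {\<omega>\<in>space (M n). L1 n (H t n \<omega>) / n < \<rho> t - \<delta>}"
          "\<omega> \<notin> ?A n \<union> ?S \<union> ?U"
        then have "real n - small n (H s n \<omega>) K - \<epsilon> * n \<le> L1 n (H t n \<omega>)"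
          by (intro not_unmerged_L1_ge) auto
        then have "(real n - small n (H s n \<omega>) K - \<epsilon> * n) / n \<le> L1 n (H t n \<omega>) / n"
          by (rule divide_right_mono) simp
        then have "1 - small n (H s n \<omega>) K / n - \<epsilon> \<le> L1 n (H t n \<omega>) / n"
          using elim by (simp add: diff_divide_distrib)
        moreover have "small n (H s n \<omega>) K / n \<le> r K s + \<epsilon>" using \<omega> by auto
        moreover have "r K s \<le> 1 - \<rho> s" using r_le_rho s by simp
        moreover have "L1 n (H t n \<omega>) / n < \<rho> t - \<delta>" using \<omega> by simp
        ultimately show False using s(3) \<epsilon>(1) by (simp add: \<epsilon>_def)
      qed
    qed (use ev in auto)
    also have "\<dots> \<le> prob (?A n \<union> ?S) + prob ?U" using ev by (intro measure_Un_le) auto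
    also have "prob (?A n \<union> ?S) \<le> prob (?A n) + prob ?S" using ev by (intro measure_Un_le) auto
    finally show ?case using elim KD assms by linarith
  qed
qed

lemma L1_conv:
  assumes "0 \<le> t"
  shows "conv_in_prob M (\<lambda>n \<omega>. L1 n (H t n \<omega>) / n) (\<rho> t)"
  unfolding conv_in_prob_def
proof (intro allI impI LIMSEQ_I)
  fix \<delta> \<eta> :: real assume "0 < \<delta>" "0 < \<eta>"
  then have "eventually (\<lambda>n. measure (M n) {\<omega>\<in>space (M n). \<rho> t + \<delta> < L1 n (H t n \<omega>) / n} < \<eta> / 2) sequentially"
    "eventually (\<lambda>n. measure (M n) {\<omega>\<in>space (M n). L1 n (H t n \<omega>) / n < \<rho> t - \<delta>} < \<eta> / 2) sequentially"
    using assms by (intro L1_upper L1_lower; simp)+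
  then have "eventually (\<lambda>n. norm (measure (M n)
      {\<omega>\<in>space (M n). \<delta> < \<bar>L1 n (H t n \<omega>) / n - \<rho> t\<bar>} - 0) < \<eta>) sequentially"
    using eventually_ge_at_top[of 1]
  proof eventually_elim
    case (elim n)
    interpret prob_space "M n" using prob_space_M elim by simp
    let ?A = "{\<omega>\<in>space (M n). \<rho> t + \<delta> < L1 n (H t n \<omega>) / n}"
      and ?B = "{\<omega>\<in>space (M n). L1 n (H t n \<omega>) / n < \<rho> t - \<delta>}"
    have ev: "?A \<in> events" "?B \<in> events" using elim by (intro H_event; simp)+
    have "{\<omega>\<in>space (M n). \<delta> < \<bar>L1 n (H t n \<omega>) / n - \<rho> t\<bar>} = ?A \<union> ?B"
      by (auto simp: abs_if)
    then show ?case using measure_Un_le[OF ev] elim by simp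
  qed
  then show "\<exists>N. \<forall>n\<ge>N. norm (measure (M n)
      {\<omega>\<in>space (M n). \<delta> < \<bar>L1 n (H t n \<omega>) / n - \<rho> t\<bar>} - 0) < \<eta>"
    by (simp add: eventually_sequentially)
qed

end

text \<open>Because \<open>\<rho>\<close> is continuous, convergence of the largest component is
  asserted at every \<open>t \<ge> 0\<close> and not only at continuity points.\<close>

theorem theorem3:
  fixes l :: nat
    and M :: "nat \<Rightarrow> 'a measure" and F :: "nat \<Rightarrow> nat \<Rightarrow> 'a measure"
    and v :: "nat \<Rightarrow> nat \<Rightarrow> 'a \<Rightarrow> nat list" and E :: "nat \<Rightarrow> nat \<Rightarrow> 'a \<Rightarrow> (nat \<times> nat) set"
    and \<rho>k :: "nat \<Rightarrow> real \<Rightarrow> real"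
  assumes "l \<ge> 2"
    and "ell_vertex_rule l M F v E"
    and "merging l M F E"
    and "\<And>k t. t \<ge> 0 \<Longrightarrow> \<rho>k k t \<in> {0..1}"
    and "\<And>k t. k \<ge> 1 \<Longrightarrow> t \<ge> 0 \<Longrightarrow>
           conv_in_prob M
             (\<lambda>n \<omega>. real (Nk n (graph_at (E n) (nat \<lfloor>t * real n\<rfloor>) \<omega>) k) / real n) (\<rho>k k t)"
  shows "\<exists>\<rho> :: real \<Rightarrow> real.
           mono_on {0..} \<rho> \<and> (\<forall>t\<ge>0. \<rho> t \<in> {0..1}) \<and>
           continuous_on {0..} \<rho> \<and>
           (\<forall>t\<ge>0. \<rho> t = 1 - (\<Sum>k. \<rho>k (Suc k) t)) \<and>
           (\<forall>t\<ge>0. conv_in_prob M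
              (\<lambda>n \<omega>. real (L1 n (graph_at (E n) (nat \<lfloor>t * real n\<rfloor>) \<omega>)) / real n) (\<rho> t))"
proof -
  interpret R: locally_convergent_rule l M F v E \<rho>k
    by (rule locally_convergent_rule.intro[OF assms])
  show ?thesis
    using R.rho_mono R.rho_bounds R.rho_continuous R.L1_conv
    by (intro exI[of _ R.\<rho>]) (auto simp: mono_on_def R.\<rho>_def R.H_def)
qed

end
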